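(* The conformal iterated function system $\mathcal{CF}_{\mathbb C}$ associated to the complex continued fractions has full spectrum; that is, $$DS(\mathcal{CF}_{\mathbb C})=[0,\dim_{\mathcal H}(J_{\mathcal{CF}_{\mathbb C}})].$$
   Context: $\mathbb N=\{1,2,\dots\}$, $\dim_{\mathcal H}$ is Hausdorff dimension ($\dim_{\mathcal H}\emptyset=0$). Let $E=\{m+ni:(m,n)\in\mathbb N\times\mathbb Z\}\subset\mathbb C$ and $X=\overline B(1/2,1/2)\subset\mathbb C$ (closed disc with centre $1/2$ and radius $1/2$). The complex continued fractions system is $\mathcal{CF}_{\mathbb C}=\{\phi_e:X\to X\}_{e\in E}$ with $\phi_e(z)=\frac1{e+z}$. (Although $|\phi_1'(0)|=1$, the system of all compositions $\phi_e\circ\phi_j$, $(e,j)\in E\times E$, is a conformal IFS, and $\mathcal{CF}_{\mathbb C}$ is treated as a conformal IFS.) For $\omega\in E^{\mathbb N}$, $\pi(\omega)$ is the unique point of $\bigcap_{n\ge1}\phi_{\omega_1}\circ\cdots\circ\phi_{\omega_n}(X)$. For $F\subset E$ put $J_F=\pi(F^{\mathbb N})$; $J_{\mathcal{CF}_{\mathbb C}}=J_E$; and $DS(\mathcal{CF}_{\mathbb C})=\{\dim_{\mathcal H}(J_F):F\subset E\}$. *)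

theory Defs
  imports "HOL-Analysis.Analysis"
begin

section \<open>Hausdorff measure and Hausdorff dimension\<close>

text \<open>
  The quantity \<open>(diam U)^s\<close>, with the usual conventions for \<open>s = 0\<close>: it is 0 for the empty set
  and 1 for every nonempty set. The case distinction is needed because \<open>0 powr 0 = 0\<close>.
\<close>

definition diam_pow :: "real \<Rightarrow> 'a::metric_space set \<Rightarrow> ennreal" where
  "diam_pow s U =
     (if U = {} then 0 else if s = 0 then 1 else ennreal (diameter U powr s))"

text \<open>
  Boundedness is required explicitly because \<^const>\<open>diameter\<close> is real-valued and carries no
  information on unbounded sets. Covers by fewer than countably many sets are obtained by padding
  with empty sets.
\<close>

definition countable_cover :: "real \<Rightarrow> 'a::metric_space set \<Rightarrow> (nat \<Rightarrow> 'a set) set" where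
  "countable_cover \<delta> A =
     {U. A \<subseteq> (\<Union>i. U i) \<and> (\<forall>i. bounded (U i) \<and> diameter (U i) \<le> \<delta>)}"

definition hausdorff_premeasure :: "real \<Rightarrow> real \<Rightarrow> 'a::metric_space set \<Rightarrow> ennreal" where
  "hausdorff_premeasure \<delta> s A = (INF U\<in>countable_cover \<delta> A. \<Sum>i. diam_pow s (U i))"

definition hausdorff_measure :: "real \<Rightarrow> 'a::metric_space set \<Rightarrow> ennreal" where
  "hausdorff_measure s A = (SUP \<delta>\<in>{0<..}. hausdorff_premeasure \<delta> s A)"

text \<open>
  Extended-valued, so that the infimum over the empty set is infinity; for subsets of the plane
  the value is always at most 2.
\<close>

definition hausdorff_dim :: "'a::metric_space set \<Rightarrow> ennreal" where
  "hausdorff_dim A = (INF s\<in>{s. 0 \<le> s \<and> hausdorff_measure s A = 0}. ennreal s)"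

section \<open>Limit sets and dimension spectrum of an iterated function system\<close>

text \<open>
  Infinite words are indexed from 0, so \<open>word_map \<phi> \<omega> n\<close> is the composition
  \<open>\<phi> (\<omega> 0) \<circ> \<dots> \<circ> \<phi> (\<omega> (n - 1))\<close> of the first \<open>n\<close> maps.
\<close>

primrec word_map :: "('e \<Rightarrow> 'a \<Rightarrow> 'a) \<Rightarrow> (nat \<Rightarrow> 'e) \<Rightarrow> nat \<Rightarrow> 'a \<Rightarrow> 'a" where
  "word_map \<phi> \<omega> 0 = id"
| "word_map \<phi> \<omega> (Suc n) = word_map \<phi> \<omega> n \<circ> \<phi> (\<omega> n)"

definition coding_map :: "('e \<Rightarrow> 'a \<Rightarrow> 'a) \<Rightarrow> 'a set \<Rightarrow> (nat \<Rightarrow> 'e) \<Rightarrow> 'a" where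
  "coding_map \<phi> X \<omega> = (THE z. z \<in> (\<Inter>n\<in>{1..}. word_map \<phi> \<omega> n ` X))"

definition limit_set :: "('e \<Rightarrow> 'a \<Rightarrow> 'a) \<Rightarrow> 'a set \<Rightarrow> 'e set \<Rightarrow> 'a set" where
  "limit_set \<phi> X F = coding_map \<phi> X ` {\<omega>. \<forall>n. \<omega> n \<in> F}"

definition dimension_spectrum ::
    "('e \<Rightarrow> 'a \<Rightarrow> 'a) \<Rightarrow> 'a::metric_space set \<Rightarrow> 'e set \<Rightarrow> ennreal set" where
  "dimension_spectrum \<phi> X E = {hausdorff_dim (limit_set \<phi> X F) | F. F \<subseteq> E}"

section \<open>Complex continued fractions\<close>

definition cf_alphabet :: "complex set" where
  "cf_alphabet = {of_nat m + of_int n * \<i> | (m::nat) (n::int). 1 \<le> m}"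

definition cf_domain :: "complex set" where
  "cf_domain = cball (1/2) (1/2)"

definition cf_map :: "complex \<Rightarrow> complex \<Rightarrow> complex" where
  "cf_map e z = 1 / (e + z)"

end

theory Submission
  imports Defs "HOL-Library.Sublist"
begin

text \<open>
  Fix \<open>0 < t < dim J\<^sub>E\<close> and run through the digits in a suitable order, accepting a digit whenever the
  limit set of the digits accepted so far together with the new one has dimension at most \<open>t\<close>. The
  dimension of a system is the supremum over its finite subsystems, so the accepted set \<open>F\<close> has
  dimension at most \<open>t\<close>. If it were smaller than \<open>t\<close>, then all large digits would be accepted, as adding
  one of them changes the dimension only little; hence there would be a last rejected digit \<open>e\<close>. All
  digits after \<open>e\<close> belong to \<open>F\<close>, and exchanging \<open>e\<close> for these does not decrease the dimension, a
  contradiction.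

  Dimensions are controlled by the sums \<open>Z\<^sub>n\<close> of \<open>\<bar>\<phi>\<^sub>w'\<bar>\<^sup>t\<close> over the words \<open>w\<close> of length \<open>n\<close>: bounded \<open>Z\<^sub>n\<close> give
  dimension at most \<open>t\<close>, while for a finite alphabet dimension below \<open>t\<close> makes \<open>\<Sum>\<^sub>n Z\<^sub>n\<close> converge, to a
  strictly superharmonic function of the transfer operator. The exchange step reduces to
  \<open>\<Sum>\<^sub>d \<bar>(e + \<zeta>) / (d + \<zeta>)\<bar>\<^sup>2\<^sup>t \<ge> 1\<close> for \<open>\<zeta>\<close> in the disc \<open>\<bar>\<zeta> - 1\<bar> \<le> 1\<close>, where \<open>d\<close> runs through finitely many
  digits after \<open>e\<close>. It suffices to check this for \<open>t = 2\<close>. For \<open>e = 1 \<plusminus> \<i>\<close> there is hardly any room in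
  that case, but the system \<open>{1, 1 \<plusminus> \<i>}\<close> has dimension at most \<open>3/2\<close>, so that \<open>t = 3/2\<close> is enough; and
  \<open>e = 1\<close> is the first digit, whose system is a point.
\<close>

subsection \<open>The maps and their domain\<close>

text \<open>Inversion turns |z|^2 \<le> Re z into 1 \<le> Re (1/z), so that 1/w lies in the disc
  whenever Re w \<ge> 1, as holds for w = e + z.\<close>

lemma cf_domain_iff: "z \<in> cf_domain \<longleftrightarrow> (cmod z)\<^sup>2 \<le> Re z"
proof -
  have "z \<in> cf_domain \<longleftrightarrow> cmod (1/2 - z) \<le> 1/2"
    by (simp add: cf_domain_def dist_norm)
  also have "\<dots> \<longleftrightarrow> (cmod (1/2 - z))\<^sup>2 \<le> (1/2)\<^sup>2"
    by (simp add: power2_le_iff_abs_le)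
  also have "\<dots> \<longleftrightarrow> (cmod z)\<^sup>2 \<le> Re z"
    unfolding cmod_power2 by (simp add: power2_eq_square algebra_simps) linarith
  finally show ?thesis .
qed

lemma cf_domain_Re_nonneg: "z \<in> cf_domain \<Longrightarrow> 0 \<le> Re z"
  unfolding cf_domain_iff by (meson order_trans zero_le_power2)

lemma zero_in_cf_domain: "0 \<in> cf_domain" and half_in_cf_domain: "1/2 \<in> cf_domain"
  by (simp_all add: cf_domain_def)

lemma cf_domain_dist: "x \<in> cf_domain \<Longrightarrow> y \<in> cf_domain \<Longrightarrow> cmod (x - y) \<le> 1"
  using dist_triangle3[of x y "1/2"] by (simp add: cf_domain_def dist_norm)

lemma cf_alphabet_Re: "e \<in> cf_alphabet \<Longrightarrow> 1 \<le> Re e"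
  unfolding cf_alphabet_def by auto

text \<open>The squared modulus of the difference is a positive integer.\<close>

lemma cf_alphabet_separated:
  assumes "e \<in> cf_alphabet" "e' \<in> cf_alphabet" "e \<noteq> e'"
  shows "1 \<le> cmod (e - e')"
proof -
  obtain m n m' n' where e: "e = of_nat m + of_int n * \<i>" and e': "e' = of_nat m' + of_int n' * \<i>"
    using assms unfolding cf_alphabet_def by blast
  let ?a = "int m - int m'" and ?b = "n - n'"
  have d: "e - e' = Complex (of_int ?a) (of_int ?b)"
    by (simp add: e e' complex_eq_iff)
  have "?a \<noteq> 0 \<or> ?b \<noteq> 0" using assms(3) by (auto simp: e e')
  then have "1 \<le> ?a\<^sup>2 + ?b\<^sup>2"
    by (smt (verit) zero_less_power2 zero_le_power2)
  then have "1 \<le> (of_int (?a\<^sup>2 + ?b\<^sup>2) :: real)" by linarith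
  then show ?thesis
    unfolding d cmod_def by simp
qed

lemma cmod_digit_add_ge:
  assumes "1 \<le> Re e" "z \<in> cf_domain"
  shows "1 \<le> cmod (e + z)"
  using assms(1) cf_domain_Re_nonneg[OF assms(2)] complex_Re_le_cmod[of "e + z"] by simp

lemma cf_map_in_cf_domain:
  assumes "1 \<le> Re e" "z \<in> cf_domain"
  shows "cf_map e z \<in> cf_domain"
proof -
  have r: "1 \<le> Re (e + z)" using assms(1) cf_domain_Re_nonneg[OF assms(2)] by simp
  have "(cmod (1 / (e + z)))\<^sup>2 = 1 / (cmod (e + z))\<^sup>2" by (simp add: norm_divide power_divide)
  also have "\<dots> \<le> Re (e + z) / (cmod (e + z))\<^sup>2"
    using r by (intro divide_right_mono) auto
  also have "\<dots> = Re (1 / (e + z))" by (simp add: Re_divide cmod_power2)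
  finally show ?thesis by (simp add: cf_domain_iff cf_map_def)
qed

subsection \<open>Compositions along finite words\<close>

definition wmap :: "complex list \<Rightarrow> complex \<Rightarrow> complex" where
  "wmap w = foldr cf_map w"

text \<open>The modulus of the derivative of \<^const>\<open>wmap\<close>, by the chain rule.\<close>

primrec wder :: "complex list \<Rightarrow> complex \<Rightarrow> real" where
  "wder [] z = 1"
| "wder (e # w) z = wder w z / (cmod (e + wmap w z))\<^sup>2"

lemma wmap_simps [simp]: "wmap [] z = z" "wmap (e # w) z = cf_map e (wmap w z)"
  by (simp_all add: wmap_def)

lemma wmap_append: "wmap (u @ v) z = wmap u (wmap v z)"
  by (simp add: wmap_def)

lemma wder_append: "wder (u @ v) z = wder u (wmap v z) * wder v z"
  by (induction u) (simp_all add: wmap_append)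

abbreviation digits :: "complex list \<Rightarrow> bool" where
  "digits w \<equiv> (\<forall>e\<in>set w. 1 \<le> Re e)"

lemma wmap_in_cf_domain: "digits w \<Longrightarrow> z \<in> cf_domain \<Longrightarrow> wmap w z \<in> cf_domain"
  by (induction w) (auto intro: cf_map_in_cf_domain)

lemma wder_pos:
  assumes "digits w" "z \<in> cf_domain"
  shows "0 < wder w z"
  using assms
proof (induction w)
  case (Cons e w)
  then have "e + wmap w z \<noteq> 0"
    using cmod_digit_add_ge[of e "wmap w z"] wmap_in_cf_domain[of w z] by auto
  then show ?case using Cons by simp
qed simp

text \<open>In 1/a - 1/b = (b - a)/(a b) the factor 1/(a b) is shared between the derivatives at the
  two points, so the mean value estimate becomes an identity along the whole word.\<close>

lemma dist_wmap:
  assumes "digits w" "x \<in> cf_domain" "y \<in> cf_domain"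
  shows "(cmod (wmap w x - wmap w y))\<^sup>2 = wder w x * wder w y * (cmod (x - y))\<^sup>2"
  using assms
proof (induction w)
  case (Cons e w)
  let ?a = "e + wmap w x" and ?b = "e + wmap w y"
  have "1 \<le> cmod ?a" "1 \<le> cmod ?b"
    using Cons.prems by (auto intro!: cmod_digit_add_ge wmap_in_cf_domain)
  then have nz: "?a \<noteq> 0" "?b \<noteq> 0" by (metis norm_zero not_one_le_zero)+
  then have "1 / ?a - 1 / ?b = (wmap w y - wmap w x) / (?a * ?b)"
    by (simp add: field_simps)
  then have "(cmod (1 / ?a - 1 / ?b))\<^sup>2 = (cmod (wmap w x - wmap w y))\<^sup>2 / ((cmod ?a)\<^sup>2 * (cmod ?b)\<^sup>2)"
    by (simp add: norm_divide norm_mult power_divide power_mult_distrib norm_minus_commute)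
  then show ?case using Cons nz by (simp add: cf_map_def field_simps)
qed simp

lemma continuous_on_wmap: "digits w \<Longrightarrow> continuous_on cf_domain (wmap w)"
proof (induction w)
  case Nil
  show ?case by (simp add: wmap_def)
next
  case (Cons e w)
  have nz: "e + wmap w x \<noteq> 0" if "x \<in> cf_domain" for x
    using cmod_digit_add_ge[of e "wmap w x"] that Cons.prems
    by (metis list.set_intros norm_zero not_one_le_zero wmap_in_cf_domain)
  have "continuous_on cf_domain (\<lambda>x. 1 / (e + wmap w x))"
    using Cons nz by (intro continuous_intros) auto
  then show ?case by (simp add: cf_map_def wmap_def)
qed

text \<open>
  Every \<open>\<phi>\<^sub>w\<close> is a Moebius map \<open>(az + b) / (cz + d)\<close> of determinant \<open>\<plusminus>1\<close>, so that its derivative has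
  modulus \<open>1 / \<bar>cz + d\<bar>\<^sup>2\<close>; here \<open>\<kappa> = c / d\<close>, which is again given by a continued fraction.
\<close>

lemma wder_form:
  assumes "digits w"
  obtains c \<kappa> where "0 < c" "\<kappa> \<in> cf_domain"
    "\<And>z. z \<in> cf_domain \<Longrightarrow> wder w z = c / (cmod (1 + \<kappa> * z))\<^sup>2"
    "\<And>d z. 1 \<le> Re d \<Longrightarrow> z \<in> cf_domain \<Longrightarrow> wder (w @ [d]) z = c / (cmod (d + (z + \<kappa>)))\<^sup>2"
proof -
  have snoc_form: "wder (w @ [d]) z = c / (cmod (d + (z + \<kappa>)))\<^sup>2"
    if "1 \<le> Re d" "z \<in> cf_domain" "\<And>z. z \<in> cf_domain \<Longrightarrow> wder w z = c / (cmod (1 + \<kappa> * z))\<^sup>2"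
    for w c \<kappa> d z
  proof -
    have nz: "d + z \<noteq> 0" using cmod_digit_add_ge[OF that(1,2)] by auto
    have "wder (w @ [d]) z = c / (cmod (1 + \<kappa> / (d + z)))\<^sup>2 / (cmod (d + z))\<^sup>2"
      using that(3)[OF cf_map_in_cf_domain[OF that(1,2)]]
      by (simp add: wder_append cf_map_def)
    also have "\<dots> = c / (cmod ((1 + \<kappa> / (d + z)) * (d + z)))\<^sup>2"
      by (simp add: norm_mult power_mult_distrib)
    also have "(1 + \<kappa> / (d + z)) * (d + z) = d + (z + \<kappa>)" using nz by (simp add: field_simps)
    finally show ?thesis .
  qed
  have "\<exists>c \<kappa>. 0 < c \<and> \<kappa> \<in> cf_domain \<and> (\<forall>z\<in>cf_domain. wder w z = c / (cmod (1 + \<kappa> * z))\<^sup>2)"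
    using assms
  proof (induction w rule: rev_induct)
    case Nil
    show ?case by (intro exI[of _ 1] exI[of _ 0]) (auto simp: zero_in_cf_domain)
  next
    case (snoc d w)
    then obtain c \<kappa> where IH: "0 < c" "\<kappa> \<in> cf_domain"
      "\<And>z. z \<in> cf_domain \<Longrightarrow> wder w z = c / (cmod (1 + \<kappa> * z))\<^sup>2" by auto
    have d: "1 \<le> Re d" using snoc by auto
    have nz: "d + \<kappa> \<noteq> 0" using cmod_digit_add_ge[OF d IH(2)] by auto
    have "wder (w @ [d]) z = c / (cmod (d + \<kappa>))\<^sup>2 / (cmod (1 + cf_map d \<kappa> * z))\<^sup>2"
      if "z \<in> cf_domain" for z
    proof -
      have "d + (z + \<kappa>) = (d + \<kappa>) * (1 + cf_map d \<kappa> * z)"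
        using nz by (simp add: cf_map_def field_simps)
      then show ?thesis using snoc_form[OF d that IH(3)]
        by (simp add: norm_mult power_mult_distrib)
    qed
    moreover have "0 < c / (cmod (d + \<kappa>))\<^sup>2" using IH(1) nz by simp
    ultimately show ?case using cf_map_in_cf_domain[OF d IH(2)] by blast
  qed
  then show ?thesis using that snoc_form by metis
qed

lemma wder_distortion:
  assumes "digits w" "x \<in> cf_domain" "y \<in> cf_domain"
  shows "wder w x \<le> 8 * wder w y"
proof -
  obtain c \<kappa> where l: "0 < c" "\<kappa> \<in> cf_domain"
    "\<And>z. z \<in> cf_domain \<Longrightarrow> wder w z = c / (cmod (1 + \<kappa> * z))\<^sup>2"
    using wder_form[OF assms(1)] by metis
  have cmod_1: "cmod z \<le> 1" and cI: "\<bar>Im z\<bar> \<le> 1/2" if "z \<in> cf_domain" for z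
  proof -
    show "cmod z \<le> 1" using cf_domain_dist[OF that zero_in_cf_domain] by simp
    have "\<bar>Im (1/2 - z)\<bar> \<le> cmod (1/2 - z)" by (rule abs_Im_le_cmod)
    then show "\<bar>Im z\<bar> \<le> 1/2" using that by (simp add: cf_domain_def dist_norm)
  qed
  \<comment> \<open>The moduli of the denominators lie between 3/4 and 2, so derivatives vary by a
    factor of at most (2 / (3/4))^2 = 64/9 \<le> 8.\<close>
  have "cmod (1 + \<kappa> * y) \<le> 1 + cmod \<kappa> * cmod y"
    using norm_triangle_ineq[of 1 "\<kappa> * y"] by (simp add: norm_mult)
  also have "\<dots> \<le> 2" using mult_le_one[OF cmod_1[OF l(2)] _ cmod_1[OF assms(3)]] by simp
  finally have up: "(cmod (1 + \<kappa> * y))\<^sup>2 \<le> 2\<^sup>2" by (intro power_mono) auto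
  have "Im \<kappa> * Im x \<le> \<bar>Im \<kappa>\<bar> * \<bar>Im x\<bar>" by (metis abs_ge_self abs_mult)
  also have "\<dots> \<le> 1/2 * (1/2)" using cI l(2) assms(2) by (intro mult_mono) auto
  finally have "3/4 \<le> Re (1 + \<kappa> * x)"
    using mult_nonneg_nonneg[OF cf_domain_Re_nonneg[OF l(2)] cf_domain_Re_nonneg[OF assms(2)]]
    by simp
  then have "3/4 \<le> cmod (1 + \<kappa> * x)" using complex_Re_le_cmod order_trans by blast
  then have low: "(3/4)\<^sup>2 \<le> (cmod (1 + \<kappa> * x))\<^sup>2" by (intro power_mono) auto
  have px: "0 < (cmod (1 + \<kappa> * x))\<^sup>2" by (rule less_le_trans[OF _ low]) simp
  have "1 + \<kappa> * y \<noteq> 0" using wder_pos[OF assms(1,3)] l(3)[OF assms(3)] by auto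
  then have py: "0 < (cmod (1 + \<kappa> * y))\<^sup>2" by simp
  have "c / (cmod (1 + \<kappa> * x))\<^sup>2 \<le> c / (3/4)\<^sup>2"
    using l(1) px by (intro divide_left_mono[OF low] mult_pos_pos) simp_all
  also have "\<dots> \<le> 8 * (c / 2\<^sup>2)" using l(1) by (simp add: power2_eq_square)
  also have "\<dots> \<le> 8 * (c / (cmod (1 + \<kappa> * y))\<^sup>2)"
    using up l(1) py by (intro mult_left_mono divide_left_mono) auto
  finally show ?thesis using l(3) assms by simp
qed

text \<open>Since Re v \<ge> 1 gives Re (1/v) \<ge> 1/|v|^2, the product is at least |v| + 1/|v|.
  Here v is the inner of two consecutive denominators.\<close>

lemma cmod_digit_pair_ge:
  assumes "1 \<le> Re e" "1 \<le> Re v"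
  shows "2 \<le> cmod v * cmod (e + 1 / v)"
proof -
  have v: "1 \<le> cmod v" using assms(2) complex_Re_le_cmod[of v] by simp
  have "Re (1 / v) = Re v / (cmod v)\<^sup>2" by (simp add: Re_divide cmod_power2)
  then have "1 + 1 / (cmod v)\<^sup>2 \<le> Re (e + 1 / v)"
    using assms divide_right_mono[OF assms(2), of "(cmod v)\<^sup>2"] by simp
  also have "\<dots> \<le> cmod (e + 1 / v)" by (rule complex_Re_le_cmod)
  finally have "cmod v * (1 + 1 / (cmod v)\<^sup>2) \<le> cmod v * cmod (e + 1 / v)"
    by (simp add: mult_left_mono)
  moreover have "cmod v * (1 + 1 / (cmod v)\<^sup>2) = cmod v + 1 / cmod v"
    using v by (simp add: field_simps power2_eq_square)
  moreover have "2 \<le> cmod v + 1 / cmod v"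
  proof -
    have "0 \<le> (cmod v - 1)\<^sup>2" by simp
    then have "2 * cmod v \<le> cmod v * cmod v + 1" by (simp add: power2_eq_square algebra_simps)
    then have "2 * cmod v / cmod v \<le> (cmod v * cmod v + 1) / cmod v"
      using v by (intro divide_right_mono) auto
    moreover have "v \<noteq> 0" using v by auto
    ultimately show ?thesis by (simp add: add_divide_distrib)
  qed
  ultimately show ?thesis by linarith
qed

text \<open>A single map need not contract (\<open>\<phi>\<^sub>1\<close> has derivative \<open>-1\<close> at \<open>0\<close>), but pairs of them do.\<close>

lemma wder_le:
  assumes "digits w" "z \<in> cf_domain"
  shows "wder w z \<le> 2 * (1/2) ^ length w"
  using assms
proof (induction w rule: induct_list012)
  case (2 e)
  have "1 \<le> (cmod (e + z))\<^sup>2" using cmod_digit_add_ge[of e z] 2 by simp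
  then show ?case by (simp add: divide_le_eq)
next
  case (3 e f w)
  let ?v = "f + wmap w z"
  have z': "wmap w z \<in> cf_domain" using 3 wmap_in_cf_domain by simp
  have v: "1 \<le> Re ?v" using 3 cf_domain_Re_nonneg[OF z'] by auto
  have "2\<^sup>2 \<le> (cmod ?v * cmod (e + 1 / ?v))\<^sup>2"
    using cmod_digit_pair_ge[OF _ v, of e] 3 by (intro power_mono) auto
  then have P: "4 \<le> (cmod ?v * cmod (e + 1 / ?v))\<^sup>2" by simp
  have "wder (e # f # w) z = wder w z / (cmod ?v * cmod (e + 1 / ?v))\<^sup>2"
    by (simp add: cf_map_def power_mult_distrib)
  also have "\<dots> \<le> wder w z / 4"
    using P wder_pos[of w z] 3 by (intro divide_left_mono) auto
  finally have "wder (e # f # w) z \<le> wder w z / 4" .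
  moreover have "wder w z \<le> 2 * (1/2) ^ length w" using 3 by simp
  ultimately show ?case by (simp del: wder.simps)
qed simp

lemma wder_le_1:
  assumes "digits w" "z \<in> cf_domain"
  shows "wder w z \<le> 1"
  using assms
proof (induction w)
  case (Cons e w)
  have "1 \<le> (cmod (e + wmap w z))\<^sup>2"
    using cmod_digit_add_ge[of e "wmap w z"] wmap_in_cf_domain Cons.prems by simp
  then show ?case using Cons wder_pos[of w z] by (simp add: divide_le_eq)
qed simp

text \<open>The image disc contains a disc of radius comparable to the derivative.\<close>

lemma wmap_half_inside:
  assumes "digits w"
  shows "wder w (1/2) / 2 \<le> 1/2 - cmod (wmap w (1/2) - 1/2)"
proof -
  \<comment> \<open>The left side is minus the power of z with respect to the boundary circle; it
    factors as (1/2 - r)(1/2 + r) with r \<le> 1/2.\<close>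
  have inside: "Re z - (cmod z)\<^sup>2 \<le> 1/2 - cmod (z - 1/2)" if "z \<in> cf_domain" for z
  proof -
    let ?r = "cmod (z - 1/2)"
    have "?r \<le> 1/2" using that by (simp add: cf_domain_def dist_norm norm_minus_commute)
    moreover have "Re z - (cmod z)\<^sup>2 = (1/2 - ?r) * (1/2 + ?r)"
      using cmod_power2[of "z - 1/2"] cmod_power2[of z] by (simp add: power2_eq_square algebra_simps)
    ultimately show ?thesis by (simp add: mult_left_le)
  qed
  show ?thesis
  proof (cases w)
    case (Cons e u)
    let ?y = "wmap u (1/2)"
    have y: "?y \<in> cf_domain" using assms Cons half_in_cf_domain wmap_in_cf_domain by auto
    have e: "1 \<le> Re e" using assms Cons by auto
    \<comment> \<open>For p = e + y one has Re (1/p) - |1/p|^2 = (Re p - 1) / |p|^2, and Re p - 1 is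
      at least Re y; hence a lower bound for Re y suffices.\<close>
    have Re_y: "wder u (1/2) / 2 \<le> Re ?y"
    proof (cases u)
      case (Cons f u')
      let ?v = "f + wmap u' (1/2)"
      have u': "digits u'" "wmap u' (1/2) \<in> cf_domain" and f: "1 \<le> Re f"
        using assms Cons \<open>w = _\<close> half_in_cf_domain wmap_in_cf_domain by auto
      have "1 \<le> Re ?v" using f cf_domain_Re_nonneg[OF u'(2)] by simp
      then have "1 / (cmod ?v)\<^sup>2 \<le> Re (1 / ?v)"
        by (simp add: Re_divide cmod_power2 divide_right_mono)
      moreover have "wder u' (1/2) / 2 / (cmod ?v)\<^sup>2 \<le> 1 / (cmod ?v)\<^sup>2"
        using wder_le_1[OF u'(1) half_in_cf_domain] by (intro divide_right_mono) auto
      ultimately show ?thesis using Cons by (simp add: cf_map_def)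
    qed simp
    have "wder w (1/2) / 2 = wder u (1/2) / 2 / (cmod (e + ?y))\<^sup>2" using Cons by simp
    also have "\<dots> \<le> (Re (e + ?y) - 1) / (cmod (e + ?y))\<^sup>2"
      using Re_y e by (intro divide_right_mono) auto
    also have "\<dots> = Re (1 / (e + ?y)) - (cmod (1 / (e + ?y)))\<^sup>2"
      by (simp add: Re_divide cmod_power2 norm_divide power_divide diff_divide_distrib)
    also have "\<dots> = Re (wmap w (1/2)) - (cmod (wmap w (1/2)))\<^sup>2"
      using Cons by (simp add: cf_map_def)
    also have "\<dots> \<le> 1/2 - cmod (wmap w (1/2) - 1/2)"
      using assms half_in_cf_domain wmap_in_cf_domain by (intro inside) auto
    finally show ?thesis .
  qed simp
qed

text \<open>The open set condition, in quantitative form.\<close>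

lemma wmap_half_separated:
  assumes "set w \<subseteq> cf_alphabet" "set w' \<subseteq> cf_alphabet"
    and w: "w = v @ e # u" and w': "w' = v @ e' # u'" and "e \<noteq> e'"
  shows "wder w (1/2) * wder w' (1/2) \<le> (cmod (wmap w (1/2) - wmap w' (1/2)))\<^sup>2"
proof -
  let ?x = "wmap u (1/2)" and ?x' = "wmap u' (1/2)"
  have dg: "digits v" "digits u" "digits u'" "1 \<le> Re e" "1 \<le> Re e'"
    and ee: "e \<in> cf_alphabet" "e' \<in> cf_alphabet"
    using assms cf_alphabet_Re by auto
  have x: "?x \<in> cf_domain" "?x' \<in> cf_domain" using dg half_in_cf_domain wmap_in_cf_domain by auto
  have nz: "1 \<le> cmod (e + ?x)" "1 \<le> cmod (e' + ?x')" using cmod_digit_add_ge dg x by auto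
  define s where "s = wder u (1/2)"
  define s' where "s' = wder u' (1/2)"
  have s: "0 < s" "0 < s'" using wder_pos dg half_in_cf_domain by (auto simp: s_def s'_def)
  \<comment> \<open>Without the common prefix and the inversion, the points lie in discs of radius
    1/2 around e + 1/2 and e' + 1/2, at depths at least s/2 and s'/2. The centres are at least 1
    apart, so the points are at least (s + s')/2 apart.\<close>
  have ee': "e - e' = (((e + ?x) - (e' + ?x')) - (?x - 1/2)) + (?x' - 1/2)" by simp
  have "cmod (e - e') \<le> cmod ((e + ?x) - (e' + ?x')) + cmod (?x - 1/2) + cmod (?x' - 1/2)"
    unfolding ee' using norm_triangle_ineq[of "((e + ?x) - (e' + ?x')) - (?x - 1/2)" "?x' - 1/2"]
      norm_triangle_ineq4[of "(e + ?x) - (e' + ?x')" "?x - 1/2"]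
    by linarith
  then have "(s + s') / 2 \<le> cmod ((e + ?x) - (e' + ?x'))"
    using cf_alphabet_separated[OF ee \<open>e \<noteq> e'\<close>] wmap_half_inside[OF dg(2)] wmap_half_inside[OF dg(3)]
    by (simp add: s_def s'_def)
  then have "((s + s') / 2)\<^sup>2 \<le> (cmod ((e + ?x) - (e' + ?x')))\<^sup>2"
    using s by (intro power_mono) auto
  moreover have "s * s' \<le> ((s + s') / 2)\<^sup>2"
  proof -
    have "0 \<le> (s - s')\<^sup>2" by simp
    then show ?thesis by (simp add: power2_eq_square algebra_simps)
  qed
  ultimately have key: "s * s' \<le> (cmod ((e + ?x) - (e' + ?x')))\<^sup>2" by linarith
  have nz': "e + ?x \<noteq> 0" "e' + ?x' \<noteq> 0" using nz by auto
  have "cf_map e ?x - cf_map e' ?x' = - ((e + ?x) - (e' + ?x')) / ((e + ?x) * (e' + ?x'))"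
    using nz' by (simp add: cf_map_def field_simps)
  then have dd: "(cmod (cf_map e ?x - cf_map e' ?x'))\<^sup>2 =
      (cmod ((e + ?x) - (e' + ?x')))\<^sup>2 / ((cmod (e + ?x))\<^sup>2 * (cmod (e' + ?x'))\<^sup>2)"
    by (simp only: norm_divide norm_mult norm_minus_cancel power_divide power_mult_distrib)
  have cx: "cf_map e ?x \<in> cf_domain" "cf_map e' ?x' \<in> cf_domain"
    using cf_map_in_cf_domain dg x by auto
  have "wder w (1/2) * wder w' (1/2) = wder v (cf_map e ?x) * wder v (cf_map e' ?x') *
      (s * s' / ((cmod (e + ?x))\<^sup>2 * (cmod (e' + ?x'))\<^sup>2))"
    by (simp add: w w' wder_append wmap_append s_def s'_def)
  also have "\<dots> \<le> wder v (cf_map e ?x) * wder v (cf_map e' ?x') * (cmod (cf_map e ?x - cf_map e' ?x'))\<^sup>2"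
    unfolding dd using key wder_pos[OF dg(1)] cx
    by (intro mult_left_mono divide_right_mono) (auto intro!: mult_nonneg_nonneg less_imp_le)
  also have "\<dots> = (cmod (wmap w (1/2) - wmap w' (1/2)))\<^sup>2"
    using dist_wmap[OF dg(1) cx] by (simp add: w w' wmap_append)
  finally show ?thesis .
qed

lemma wmap_image_bounded: "digits w \<Longrightarrow> bounded (wmap w ` cf_domain)"
  using compact_continuous_image[OF continuous_on_wmap] compact_imp_bounded
  by (metis cf_domain_def compact_cball)

lemma dist_wmap_le:
  assumes "digits w" "x \<in> cf_domain" "y \<in> cf_domain"
  shows "cmod (wmap w x - wmap w y) \<le> 8 * wder w (1/2)"
proof -
  have p: "0 < wder w (1/2)" "0 < wder w x" "0 < wder w y"
    using wder_pos assms half_in_cf_domain by auto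
  have "(cmod (wmap w x - wmap w y))\<^sup>2 = wder w x * wder w y * (cmod (x - y))\<^sup>2"
    by (rule dist_wmap[OF assms])
  also have "\<dots> \<le> (8 * wder w (1/2)) * (8 * wder w (1/2)) * 1\<^sup>2"
    using p wder_distortion[OF assms(1) _ half_in_cf_domain] assms cf_domain_dist
    by (intro mult_mono power_mono) auto
  finally have "(cmod (wmap w x - wmap w y))\<^sup>2 \<le> (8 * wder w (1/2))\<^sup>2" by (simp add: power2_eq_square)
  then show ?thesis by (rule power2_le_imp_le) (use p in simp)
qed

lemma diameter_wmap_image_le:
  assumes "digits w"
  shows "diameter (wmap w ` cf_domain) \<le> 8 * wder w (1/2)"
  using dist_wmap_le[OF assms] half_in_cf_domain
  by (intro diameter_le) auto

subsection \<open>Upper bounds for the Hausdorff dimension\<close>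

text \<open>Reindexes a countable family by the naturals, padding with empty sets, which
  \<open>diam_pow\<close> counts as 0 even for s = 0. Only finite subsums have to be
  bounded.\<close>

lemma hausdorff_premeasure_le:
  fixes A :: "'a::metric_space set" and U :: "'i \<Rightarrow> 'a set"
  assumes I: "countable I" and A: "A \<subseteq> (\<Union>i\<in>I. U i)" and "0 \<le> \<delta>"
    and U: "\<And>i. i \<in> I \<Longrightarrow> bounded (U i) \<and> diameter (U i) \<le> \<delta>"
    and C: "\<And>J. finite J \<Longrightarrow> J \<subseteq> I \<Longrightarrow> (\<Sum>i\<in>J. diam_pow s (U i)) \<le> C"
  shows "hausdorff_premeasure \<delta> s A \<le> C"
proof -
  let ?N = "to_nat_on I ` I"
  define V where "V k = (if k \<in> ?N then U (from_nat_into I k) else {})" for k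
  have inI: "from_nat_into I k \<in> I" if "k \<in> ?N" for k
    using that from_nat_into_to_nat_on[OF I] by auto
  have "A \<subseteq> (\<Union>k. V k)"
  proof
    fix x assume "x \<in> A"
    then obtain i where "i \<in> I" "x \<in> U i" using A by auto
    then have "x \<in> V (to_nat_on I i)" using I by (simp add: V_def)
    then show "x \<in> (\<Union>k. V k)" by blast
  qed
  then have "V \<in> countable_cover \<delta> A"
    using U inI \<open>0 \<le> \<delta>\<close> by (auto simp: countable_cover_def V_def)
  moreover have "(\<Sum>k. diam_pow s (V k)) \<le> C"
  proof (rule suminf_le_const)
    fix n
    let ?J = "from_nat_into I ` ({..<n} \<inter> ?N)"
    have inj: "inj_on (from_nat_into I) ({..<n} \<inter> ?N)"
      by (rule inj_on_inverseI[of _ "to_nat_on I"]) auto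
    have "(\<Sum>k<n. diam_pow s (V k)) = (\<Sum>k\<in>{..<n} \<inter> ?N. diam_pow s (U (from_nat_into I k)))"
      by (rule sum.mono_neutral_cong_right) (auto simp: V_def diam_pow_def)
    also have "\<dots> = (\<Sum>i\<in>?J. diam_pow s (U i))"
      by (simp add: sum.reindex[OF inj])
    also have "\<dots> \<le> C" using inI by (intro C) auto
    finally show "(\<Sum>k<n. diam_pow s (V k)) \<le> C" .
  qed simp
  ultimately show ?thesis
    unfolding hausdorff_premeasure_def by (rule INF_lower2[of V])
qed

text \<open>Bounded sums at exponent t suffice, because at exponent t + e each term gains a factor
  that tends to 0 with \<open>r n\<close>.\<close>

lemma hausdorff_dim_le_of_covers:
  fixes A :: "'a::metric_space set" and U :: "nat \<Rightarrow> 'i \<Rightarrow> 'a set"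
  assumes "0 < t" and r: "r \<longlonglongrightarrow> 0"
    and I: "\<And>n. countable (I n)" and A: "\<And>n. A \<subseteq> (\<Union>i\<in>I n. U n i)"
    and U: "\<And>n i. i \<in> I n \<Longrightarrow> bounded (U n i) \<and> diameter (U n i) \<le> r n"
    and C: "\<And>n J. finite J \<Longrightarrow> J \<subseteq> I n \<Longrightarrow> (\<Sum>i\<in>J. diameter (U n i) powr t) \<le> C"
  shows "hausdorff_dim A \<le> ennreal t"
proof (rule ennreal_le_epsilon)
  fix e :: real assume "0 < e"
  have "hausdorff_premeasure \<delta> (t + e) A = 0" if "0 < \<delta>" for \<delta>
  proof -
    have "hausdorff_premeasure \<delta> (t + e) A \<le> 0 + ennreal \<epsilon>" if "0 < \<epsilon>" for \<epsilon>
    proof -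
      have "(\<lambda>n. C * \<bar>r n\<bar> powr e) \<longlonglongrightarrow> C * 0"
        using \<open>0 < e\<close> by (intro tendsto_mult tendsto_const tendsto_zero_powrI[where b = e])
          (auto intro!: tendsto_rabs_zero r)
      then have "eventually (\<lambda>n. C * \<bar>r n\<bar> powr e < \<epsilon> \<and> r n < \<delta>) sequentially"
        using r \<open>0 < \<epsilon>\<close> \<open>0 < \<delta>\<close> by (intro eventually_conj order_tendstoD) auto
      then obtain n where n: "C * \<bar>r n\<bar> powr e < \<epsilon>" "r n < \<delta>"
        using eventually_happens by force
      have "hausdorff_premeasure \<delta> (t + e) A \<le> ennreal \<epsilon>"
      proof (rule hausdorff_premeasure_le[OF I[of n] A[of n]])
        fix J assume J: "finite J" "J \<subseteq> I n"
        have "(\<Sum>i\<in>J. diam_pow (t + e) (U n i)) \<le> (\<Sum>i\<in>J. ennreal (diameter (U n i) powr t * \<bar>r n\<bar> powr e))"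
        proof (rule sum_mono)
          fix i assume "i \<in> J"
          then have "0 \<le> diameter (U n i)" "diameter (U n i) \<le> \<bar>r n\<bar>"
            using U[of i n] J diameter_ge_0[of "U n i"] by auto
          then have "diameter (U n i) powr (t + e) \<le> diameter (U n i) powr t * \<bar>r n\<bar> powr e"
            unfolding powr_add using \<open>0 < e\<close> by (intro mult_left_mono powr_mono2) auto
          then show "diam_pow (t + e) (U n i) \<le> ennreal (diameter (U n i) powr t * \<bar>r n\<bar> powr e)"
            using \<open>0 < t\<close> \<open>0 < e\<close> by (auto simp: diam_pow_def intro: ennreal_leI)
        qed
        also have "\<dots> = ennreal ((\<Sum>i\<in>J. diameter (U n i) powr t) * \<bar>r n\<bar> powr e)"
          by (simp add: sum_distrib_right)
        also have "\<dots> \<le> ennreal (C * \<bar>r n\<bar> powr e)"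
          using C[OF J] by (intro ennreal_leI mult_right_mono) auto
        also have "\<dots> \<le> ennreal \<epsilon>" using n by (intro ennreal_leI) auto
        finally show "(\<Sum>i\<in>J. diam_pow (t + e) (U n i)) \<le> ennreal \<epsilon>" .
      qed (use U n \<open>0 < \<delta>\<close> in \<open>force+\<close>)
      then show ?thesis by simp
    qed
    then have "hausdorff_premeasure \<delta> (t + e) A \<le> 0" by (rule ennreal_le_epsilon)
    then show ?thesis by simp
  qed
  then have "hausdorff_measure (t + e) A = 0"
    unfolding hausdorff_measure_def by (simp add: SUP_eq_const)
  then have "hausdorff_dim A \<le> ennreal (t + e)"
    unfolding hausdorff_dim_def using \<open>0 < t\<close> \<open>0 < e\<close> by (intro INF_lower) auto
  then show "hausdorff_dim A \<le> ennreal t + ennreal e"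
    using \<open>0 < t\<close> \<open>0 < e\<close> by simp
qed

lemma hausdorff_dim_mono:
  assumes "A \<subseteq> B"
  shows "hausdorff_dim A \<le> hausdorff_dim B"
proof -
  have "hausdorff_premeasure \<delta> s A \<le> hausdorff_premeasure \<delta> s B" for \<delta> s
    unfolding hausdorff_premeasure_def using assms
    by (intro INF_superset_mono) (auto simp: countable_cover_def)
  then have "hausdorff_measure s A \<le> hausdorff_measure s B" for s
    unfolding hausdorff_measure_def by (intro SUP_mono') auto
  then have "hausdorff_measure s B = 0 \<Longrightarrow> hausdorff_measure s A = 0" for s
    by (metis le_zero_eq)
  then show ?thesis
    unfolding hausdorff_dim_def by (intro INF_superset_mono) auto
qed

lemma hausdorff_dim_empty: "hausdorff_dim ({}::'a::metric_space set) = 0"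
proof -
  have "hausdorff_premeasure \<delta> 0 ({}::'a set) \<le> 0" if "0 < \<delta>" for \<delta>
    using that by (intro hausdorff_premeasure_le[where I = "{}::nat set"]) auto
  then have "hausdorff_measure 0 ({}::'a set) = 0"
    unfolding hausdorff_measure_def by (simp add: SUP_eq_const)
  then have "hausdorff_dim ({}::'a set) \<le> ennreal 0"
    unfolding hausdorff_dim_def by (intro INF_lower) auto
  then show ?thesis by simp
qed

text \<open>A grid of (n+1)^2 cells of diameter at most 2/(n+1) has squared diameters summing to at
  most 4. The bound later supplies t \<le> 2, the range in which digits can be exchanged.\<close>

lemma hausdorff_dim_cf_domain_le: "hausdorff_dim cf_domain \<le> 2"
proof -
  define U where "U n = (\<lambda>(i::nat, j::nat). {z. real i / Suc n \<le> Re z \<and> Re z \<le> (real i + 1) / Suc n \<and>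
      real j / Suc n \<le> Im z + 1/2 \<and> Im z + 1/2 \<le> (real j + 1) / Suc n})" for n
  have close: "cmod (x - y) \<le> 2 / Suc n" if "x \<in> U n p" "y \<in> U n p" for n p x y
  proof -
    obtain i j where p: "p = (i, j)" by force
    have "\<bar>Re (x - y)\<bar> \<le> (real i + 1) / Suc n - real i / Suc n"
      "\<bar>Im (x - y)\<bar> \<le> (real j + 1) / Suc n - real j / Suc n"
      using that unfolding U_def p by (auto simp: abs_le_iff)
    then have "\<bar>Re (x - y)\<bar> \<le> 1 / Suc n" "\<bar>Im (x - y)\<bar> \<le> 1 / Suc n"
      by (simp_all add: diff_divide_distrib[symmetric])
    then show ?thesis using cmod_le[of "x - y"] by simp
  qed
  have bd: "bounded (U n p)" for n p
  proof (cases "U n p = {}")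
    case False
    then obtain x where "x \<in> U n p" by auto
    then show ?thesis
      unfolding bounded_def dist_norm using close by (intro exI[of _ x] exI[of _ "2 / Suc n"]) blast
  qed simp
  have dm: "diameter (U n p) \<le> 2 / Suc n" for n p
    using close by (intro diameter_le) auto
  have fl: "\<exists>i. i \<in> {..<Suc n} \<and> real i / Suc n \<le> x \<and> x \<le> (real i + 1) / Suc n"
    if "0 \<le> x" "x \<le> 1" for x n
  proof (cases "x = 1")
    case True
    then show ?thesis by (intro exI[of _ n]) (auto simp: field_simps)
  next
    case False
    let ?i = "nat \<lfloor>x * Suc n\<rfloor>"
    have f: "real ?i \<le> x * Suc n" "x * Suc n < real ?i + 1"
      using mult_nonneg_nonneg[of x "Suc n"] that by linarith+
    have "x * Suc n < Suc n" using mult_strict_right_mono[of x 1 "real (Suc n)"] that False by simp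
    then have "?i < Suc n" using f by linarith
    then show ?thesis using f by (intro exI[of _ ?i]) (auto simp: field_simps)
  qed
  have "hausdorff_dim cf_domain \<le> ennreal 2"
  proof (rule hausdorff_dim_le_of_covers[where U = U and I = "\<lambda>n. {..<Suc n} \<times> {..<Suc n}"
        and r = "\<lambda>n. 2 / Suc n" and C = 4])
    show "cf_domain \<subseteq> (\<Union>p\<in>{..<Suc n} \<times> {..<Suc n}. U n p)" for n
    proof
      fix z assume z: "z \<in> cf_domain"
      have "\<bar>Re (1/2 - z)\<bar> \<le> 1/2" "\<bar>Im (1/2 - z)\<bar> \<le> 1/2"
        using z abs_Re_le_cmod[of "1/2 - z"] abs_Im_le_cmod[of "1/2 - z"]
        by (simp_all add: cf_domain_def dist_norm)
      then have "0 \<le> Re z" "Re z \<le> 1" "0 \<le> Im z + 1/2" "Im z + 1/2 \<le> 1"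
        unfolding abs_le_iff by simp_all
      then obtain i j where "i \<in> {..<Suc n}" "real i / Suc n \<le> Re z" "Re z \<le> (real i + 1) / Suc n"
        "j \<in> {..<Suc n}" "real j / Suc n \<le> Im z + 1/2" "Im z + 1/2 \<le> (real j + 1) / Suc n"
        using fl[of "Re z" n] fl[of "Im z + 1/2" n] by blast
      then show "z \<in> (\<Union>p\<in>{..<Suc n} \<times> {..<Suc n}. U n p)"
        by (intro UN_I[of "(i, j)"]) (auto simp: U_def)
    qed
    show "(\<Sum>p\<in>J. diameter (U n p) powr 2) \<le> 4" if "finite J" "J \<subseteq> {..<Suc n} \<times> {..<Suc n}" for n J
    proof -
      have "(\<Sum>p\<in>J. diameter (U n p) powr 2) \<le> real (card J) * (2 / Suc n) powr 2"
        using dm bd by (intro sum_bounded_above powr_mono2) (auto simp: diameter_ge_0)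
      also have "\<dots> \<le> real (Suc n * Suc n) * (2 / Suc n) powr 2"
        using card_mono[OF _ that(2)] by (intro mult_right_mono of_nat_mono) auto
      also have "\<dots> = (real (Suc n) * (2 / Suc n))\<^sup>2"
        by (subst powr_numeral) (simp, simp only: of_nat_mult power2_eq_square ac_simps)
      also have "\<dots> = 4" by (simp del: of_nat_Suc)
      finally show ?thesis .
    qed
    show "(\<lambda>n. 2 / real (Suc n)) \<longlonglongrightarrow> 0"
      using LIMSEQ_Suc[OF lim_const_over_n[of 2]] by simp
  qed (use bd dm in auto)
  then show ?thesis by simp
qed

subsection \<open>The limit sets\<close>

lemma word_map_cf_map: "word_map cf_map \<omega> n = wmap (map \<omega> [0..<n])"
  by (induction n) (auto simp: wmap_def fun_eq_iff)

text \<open>As \<open>coding_map\<close> is defined by \<open>THE\<close>, existence comes first,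
  from nested compact sets, and uniqueness from the bound 16 * 2^-n on distances inside the n-th
  image. For n = 0 the image is the whole disc.\<close>

lemma coding_map_in_image:
  assumes \<omega>: "\<And>n. 1 \<le> Re (\<omega> n)"
  shows "coding_map cf_map cf_domain \<omega> \<in> wmap (map \<omega> [0..<n]) ` cf_domain"
proof -
  let ?w = "\<lambda>n. map \<omega> [0..<n]"
  define S where "S n = wmap (?w n) ` cf_domain" for n
  have dg: "digits (?w n)" for n using \<omega> by auto
  have dec: "S (Suc n) \<subseteq> S n" for n
    using cf_map_in_cf_domain[OF \<omega>[of n]] by (auto simp: S_def wmap_append)
  have anti: "S n \<subseteq> S m" if "m \<le> n" for m n
    using lift_Suc_antimono_le[of S, OF _ that] dec by blast
  have "compact (S n)" for n
    unfolding S_def using continuous_on_wmap[OF dg]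
    by (intro compact_continuous_image) (auto simp: cf_domain_def)
  then have "\<Inter>(range S) \<noteq> {}"
    using anti half_in_cf_domain by (intro compact_nest) (auto simp: S_def)
  then obtain z where z: "z \<in> S n" for n by auto
  have uniq: "x = z" if x: "\<And>n. 1 \<le> n \<Longrightarrow> x \<in> S n" for x
  proof -
    have "cmod (x - z) \<le> 16 * (1/2) ^ n" if n: "1 \<le> n" for n
    proof -
      obtain a b where ab: "a \<in> cf_domain" "b \<in> cf_domain" "x = wmap (?w n) a" "z = wmap (?w n) b"
        using x[OF n] z[of n] by (auto simp: S_def)
      have "cmod (x - z) \<le> 8 * wder (?w n) (1/2)"
        unfolding ab(3,4) by (rule dist_wmap_le[OF dg ab(1,2)])
      also have "\<dots> \<le> 8 * (2 * (1/2) ^ n)"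
        using wder_le[OF dg[of n] half_in_cf_domain] by simp
      finally show ?thesis by simp
    qed
    then have "eventually (\<lambda>n. cmod (x - z) \<le> 16 * (1/2) ^ n) sequentially"
      using eventually_sequentially by blast
    moreover have "(\<lambda>n. 16 * (1/2) ^ n :: real) \<longlonglongrightarrow> 16 * 0"
      by (intro tendsto_mult tendsto_const LIMSEQ_power_zero) simp
    ultimately have "cmod (x - z) \<le> 16 * 0"
      by (intro tendsto_lowerbound[of _ _ sequentially]) auto
    then show ?thesis by simp
  qed
  have "coding_map cf_map cf_domain \<omega> = z"
    unfolding coding_map_def word_map_cf_map
    by (rule the_equality) (use z uniq in \<open>auto simp: S_def\<close>)
  then show ?thesis using z[of n] by (simp add: S_def)
qed

abbreviation J :: "complex set \<Rightarrow> complex set" where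
  "J \<equiv> limit_set cf_map cf_domain"

lemma limit_set_mono: "F \<subseteq> F' \<Longrightarrow> J F \<subseteq> J F'"
  unfolding limit_set_def by auto

lemma hausdorff_dim_J_mono: "F \<subseteq> F' \<Longrightarrow> hausdorff_dim (J F) \<le> hausdorff_dim (J F')"
  by (intro hausdorff_dim_mono limit_set_mono)

lemma J_empty: "J {} = {}"
  by (auto simp: limit_set_def)

lemma hausdorff_dim_J_le_2:
  assumes "F \<subseteq> cf_alphabet"
  shows "hausdorff_dim (J F) \<le> 2"
proof -
  have "J F \<subseteq> cf_domain"
    using coding_map_in_image[where n = 0] assms cf_alphabet_Re
    by (fastforce simp: limit_set_def)
  then show ?thesis using hausdorff_dim_mono hausdorff_dim_cf_domain_le order_trans by blast
qed

lemma countable_cf_alphabet: "countable cf_alphabet"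
proof -
  have "cf_alphabet \<subseteq> range (\<lambda>(m::nat, n::int). of_nat m + of_int n * \<i>)"
    by (auto simp: cf_alphabet_def)
  then show ?thesis by (rule countable_subset) auto
qed

section \<open>Finite words and partition sums\<close>

definition words :: "complex set \<Rightarrow> nat \<Rightarrow> complex list set" where
  "words G n = {w. set w \<subseteq> G \<and> length w = n}"

text \<open>For finite G this is the n-th iterate of the transfer operator at exponent t, applied to
  the constant 1 and evaluated at z.\<close>

definition partition_sum :: "complex set \<Rightarrow> real \<Rightarrow> nat \<Rightarrow> complex \<Rightarrow> real" where
  "partition_sum G t n z = (\<Sum>w\<in>words G n. wder w z powr t)"

lemma finite_words: "finite G \<Longrightarrow> finite (words G n)"
  unfolding words_def by (rule finite_lists_length_eq)

lemma partition_sum_nonneg: "0 \<le> partition_sum G t n z"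
  by (simp add: partition_sum_def sum_nonneg)

lemma words_digits: "G \<subseteq> cf_alphabet \<Longrightarrow> w \<in> words G n \<Longrightarrow> digits w"
  using cf_alphabet_Re by (auto simp: words_def)

text \<open>The images of the disc under words of length n cover the limit set, with diameters at
  most 8 times the derivative at 1/2. Finite alphabets suffice in the hypothesis because finitely
  many words use finitely many digits.\<close>

lemma hausdorff_dim_J_le:
  assumes F: "F \<subseteq> cf_alphabet" and "0 < t"
    and C: "\<And>G n. finite G \<Longrightarrow> G \<subseteq> F \<Longrightarrow> partition_sum G t n (1/2) \<le> C"
  shows "hausdorff_dim (J F) \<le> ennreal t"
proof (rule hausdorff_dim_le_of_covers[where U = "\<lambda>n w. wmap w ` cf_domain" and I = "words F"
      and r = "\<lambda>n. 16 * (1/2) ^ n" and C = "8 powr t * C"])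
  show "0 < t" by fact
  show "(\<lambda>n. 16 * (1/2) ^ n :: real) \<longlonglongrightarrow> 0"
    using tendsto_mult[OF tendsto_const LIMSEQ_power_zero[of "1/2::real"], of 16] by simp
  show "countable (words F n)" for n
    by (rule countable_subset[of _ "lists F"])
      (auto simp: words_def intro: countable_subset[OF F countable_cf_alphabet])
  show "J F \<subseteq> (\<Union>w\<in>words F n. wmap w ` cf_domain)" for n
  proof
    fix x assume "x \<in> J F"
    then obtain \<omega> where \<omega>: "\<And>n. \<omega> n \<in> F" "x = coding_map cf_map cf_domain \<omega>"
      by (auto simp: limit_set_def)
    then have "x \<in> wmap (map \<omega> [0..<n]) ` cf_domain"
      using F cf_alphabet_Re by (auto intro: coding_map_in_image)
    moreover have "map \<omega> [0..<n] \<in> words F n" using \<omega>(1) by (auto simp: words_def)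
    ultimately show "x \<in> (\<Union>w\<in>words F n. wmap w ` cf_domain)" by blast
  qed
  fix n
  have dg: "digits w" if "w \<in> words F n" for w using words_digits[OF F that] .
  show "bounded (wmap w ` cf_domain) \<and> diameter (wmap w ` cf_domain) \<le> 16 * (1/2) ^ n"
    if "w \<in> words F n" for w
    using wmap_image_bounded[OF dg[OF that]] diameter_wmap_image_le[OF dg[OF that]]
      wder_le[OF dg[OF that] half_in_cf_domain] that by (simp add: words_def)
  show "(\<Sum>w\<in>K. diameter (wmap w ` cf_domain) powr t) \<le> 8 powr t * C"
    if K: "finite K" "K \<subseteq> words F n" for K
  proof -
    let ?G = "\<Union>w\<in>K. set w"
    have G: "finite ?G" "?G \<subseteq> F" "K \<subseteq> words ?G n" using K by (auto simp: words_def)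
    have "(\<Sum>w\<in>K. diameter (wmap w ` cf_domain) powr t) \<le> (\<Sum>w\<in>K. (8 * wder w (1/2)) powr t)"
      using dg K \<open>0 < t\<close> diameter_wmap_image_le wmap_image_bounded
      by (intro sum_mono powr_mono2) (auto simp: diameter_ge_0)
    also have "\<dots> = 8 powr t * (\<Sum>w\<in>K. wder w (1/2) powr t)"
      unfolding sum_distrib_left using wder_pos[OF dg half_in_cf_domain] K
      by (intro sum.cong) (auto simp: powr_mult)
    also have "\<dots> \<le> 8 powr t * partition_sum ?G t n (1/2)"
      unfolding partition_sum_def using G finite_words by (intro mult_left_mono sum_mono2) auto
    also have "\<dots> \<le> 8 powr t * C" using C[OF G(1,2)] by (intro mult_left_mono) auto
    finally show ?thesis .
  qed
qed

subsection \<open>Lower bounds for the Hausdorff dimension\<close>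

text \<open>Passing from some s < t to t does not enlarge the terms, as the sets have diameter at
  most 1. The radii slightly exceed the diameters, so they are positive even for empty sets and
  points.\<close>

lemma covers_of_hausdorff_dim_less:
  fixes A :: "'a::metric_space set"
  assumes dim: "hausdorff_dim A < ennreal t" and "0 < \<epsilon>"
  obtains U :: "nat \<Rightarrow> 'a set" and r :: "nat \<Rightarrow> real"
  where "A \<subseteq> (\<Union>i. U i)" "\<And>i. 0 < r i" "\<And>i x y. x \<in> U i \<Longrightarrow> y \<in> U i \<Longrightarrow> dist x y \<le> r i"
    "\<And>I. finite I \<Longrightarrow> (\<Sum>i\<in>I. r i powr t) \<le> \<epsilon>"
proof -
  obtain s where s: "0 \<le> s" "hausdorff_measure s A = 0" "ennreal s < ennreal t"
    using dim unfolding hausdorff_dim_def INF_less_iff by auto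
  then have st: "s < t" by (metis ennreal_leI linorder_not_less)
  then have "0 < t" using s by simp
  have "hausdorff_premeasure 1 s A \<le> hausdorff_measure s A"
    unfolding hausdorff_measure_def by (rule SUP_upper) simp
  then have "hausdorff_premeasure 1 s A < ennreal (\<epsilon> / 2)" using s \<open>0 < \<epsilon>\<close> by simp
  then obtain U where U: "U \<in> countable_cover 1 A" "(\<Sum>i. diam_pow s (U i)) < ennreal (\<epsilon> / 2)"
    unfolding hausdorff_premeasure_def INF_less_iff by auto
  have b: "bounded (U i)" "diameter (U i) \<le> 1" and cov: "A \<subseteq> (\<Union>i. U i)" for i
    using U(1) by (auto simp: countable_cover_def)
  note d0 = diameter_ge_0[OF b(1)]
  have le: "ennreal (diameter (U i) powr t) \<le> diam_pow s (U i)" for i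
  proof (cases "U i = {} \<or> s = 0")
    case True
    then show ?thesis
      using d0[of i] b(2)[of i] \<open>0 < t\<close> powr_mono2[of t "diameter (U i)" 1]
      by (auto simp: diam_pow_def ennreal_le_1)
  next
    case False
    then show ?thesis using d0[of i] b(2)[of i] st s(1)
      by (auto simp: diam_pow_def intro!: ennreal_leI powr_mono')
  qed
  define r where "r i = (diameter (U i) powr t + \<epsilon> / 2 * (1/2) ^ Suc i) powr (1 / t)" for i
  have pos: "0 < diameter (U i) powr t + \<epsilon> / 2 * (1/2) ^ Suc i" for i
    using \<open>0 < \<epsilon>\<close> by (intro add_nonneg_pos) auto
  have rt: "r i powr t = diameter (U i) powr t + \<epsilon> / 2 * (1/2) ^ Suc i" for i
    using pos[of i] \<open>0 < t\<close> by (simp add: r_def powr_powr)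
  show ?thesis
  proof (rule that[OF cov])
    show "0 < r i" for i using pos[of i] unfolding r_def by (metis powr_gt_zero less_irrefl)
    show "dist x y \<le> r i" if "x \<in> U i" "y \<in> U i" for i x y
    proof -
      have "dist x y \<le> diameter (U i)" by (rule diameter_bounded_bound[OF b(1) that])
      also have "\<dots> = (diameter (U i) powr t) powr (1 / t)"
        using d0 \<open>0 < t\<close> by (simp add: powr_powr)
      also have "\<dots> \<le> r i"
        unfolding r_def using \<open>0 < t\<close> \<open>0 < \<epsilon>\<close> by (intro powr_mono2) auto
      finally show ?thesis .
    qed
    fix I :: "nat set" assume I: "finite I"
    have "ennreal (\<Sum>i\<in>I. diameter (U i) powr t) = (\<Sum>i\<in>I. ennreal (diameter (U i) powr t))"
      by simp
    also have "\<dots> \<le> (\<Sum>i\<in>I. diam_pow s (U i))" by (intro sum_mono le)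
    also have "\<dots> \<le> (\<Sum>i. diam_pow s (U i))" using I by (intro sum_le_suminf) auto
    also have "\<dots> \<le> ennreal (\<epsilon> / 2)" using U(2) by simp
    finally have 1: "(\<Sum>i\<in>I. diameter (U i) powr t) \<le> \<epsilon> / 2" using \<open>0 < \<epsilon>\<close> by simp
    have "(\<Sum>i\<in>I. (1/2) ^ Suc i) \<le> (1::real)"
      using sum_le_suminf[of "\<lambda>i. (1/2::real) ^ Suc i" I] I power_half_series
      by (auto simp: sums_iff)
    then have "\<epsilon> / 2 * (\<Sum>i\<in>I. (1/2) ^ Suc i) \<le> \<epsilon> / 2 * 1"
      using \<open>0 < \<epsilon>\<close> by (intro mult_left_mono) auto
    then show "(\<Sum>i\<in>I. r i powr t) \<le> \<epsilon>"
      using 1 by (simp add: rt sum.distrib sum_distrib_left)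
  qed
qed

text \<open>Packing in a grid of mesh \<rho>/2: points in one cell differ by less than \<rho>/2 in
  each coordinate, hence are closer than \<rho>, so every cell holds at most one point.\<close>

lemma card_separated_le:
  fixes p :: "'i \<Rightarrow> complex"
  assumes "0 < \<rho>" and near: "\<And>s. s \<in> S \<Longrightarrow> cmod (p s - u) \<le> K * \<rho>"
    and sep: "\<And>s s'. s \<in> S \<Longrightarrow> s' \<in> S \<Longrightarrow> s \<noteq> s' \<Longrightarrow> \<rho> \<le> cmod (p s - p s')"
  shows "finite S" "real (card S) \<le> (2 * real_of_int \<bar>\<lceil>2 * K\<rceil>\<bar> + 1)\<^sup>2"
proof -
  let ?m = "\<bar>\<lceil>2 * K\<rceil>\<bar>"
  define f where "f s = (\<lfloor>2 * Re (p s - u) / \<rho>\<rfloor>, \<lfloor>2 * Im (p s - u) / \<rho>\<rfloor>)" for s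
  have in_box: "\<lfloor>2 * a / \<rho>\<rfloor> \<in> {-?m..?m}" if "\<bar>a\<bar> \<le> K * \<rho>" for a
  proof -
    have "\<bar>2 * a / \<rho>\<bar> \<le> 2 * K" using that \<open>0 < \<rho>\<close> by (simp add: abs_mult divide_le_eq)
    then show ?thesis by (simp, linarith)
  qed
  have f: "f ` S \<subseteq> {-?m..?m} \<times> {-?m..?m}"
    unfolding f_def
    by (intro image_subsetI SigmaI in_box order_trans[OF abs_Re_le_cmod near]
        order_trans[OF abs_Im_le_cmod near])
  have close: "\<bar>a - b\<bar> < \<rho> / 2" if "\<lfloor>2 * a / \<rho>\<rfloor> = \<lfloor>2 * b / \<rho>\<rfloor>" for a b
  proof -
    have "\<bar>2 * a / \<rho> - 2 * b / \<rho>\<bar> < 1" using that by linarith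
    then have "\<bar>2 * (a - b)\<bar> / \<rho> < 1" using \<open>0 < \<rho>\<close>
      by (simp add: diff_divide_distrib[symmetric] right_diff_distrib)
    then have "2 * \<bar>a - b\<bar> < \<rho>" using \<open>0 < \<rho>\<close> by (simp only: abs_mult divide_less_eq) simp
    then show ?thesis by simp
  qed
  have inj: "inj_on f S"
  proof (rule inj_onI, rule ccontr)
    fix s s' assume s: "s \<in> S" "s' \<in> S" "f s = f s'" "s \<noteq> s'"
    have fl: "\<lfloor>2 * Re (p s - u) / \<rho>\<rfloor> = \<lfloor>2 * Re (p s' - u) / \<rho>\<rfloor>"
      "\<lfloor>2 * Im (p s - u) / \<rho>\<rfloor> = \<lfloor>2 * Im (p s' - u) / \<rho>\<rfloor>"
      using s(3) unfolding f_def prod.inject by blast+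
    show False using close[OF fl(1)] close[OF fl(2)] sep[OF s(1,2,4)] cmod_le[of "p s - p s'"] by simp
  qed
  show "finite S" by (rule inj_on_finite[OF inj f]) simp
  have "card S = card (f ` S)" using inj by (simp add: card_image)
  also have "\<dots> \<le> card ({-?m..?m} \<times> {-?m..?m})" by (rule card_mono[OF _ f]) simp
  also have "\<dots> = (nat (2 * ?m + 1))\<^sup>2" by (simp add: card_cartesian_product power2_eq_square algebra_simps)
  finally have "real (card S) \<le> real ((nat (2 * ?m + 1))\<^sup>2)" by (rule of_nat_mono)
  then show "real (card S) \<le> (2 * real_of_int ?m + 1)\<^sup>2" by simp
qed

text \<open>Koenig's lemma: \<open>ext v\<close> says that v has bad extensions of every length, and
  as the alphabet is finite, some digit can be appended without losing this.\<close>

lemma Koenig_words: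
  assumes "finite G" and bad: "\<And>n. \<exists>w\<in>words G n. bad w"
    and prefix: "\<And>u v. bad (u @ v) \<Longrightarrow> bad u"
  obtains \<omega> where "\<And>n. \<omega> n \<in> G" "\<And>n. bad (map \<omega> [0..<n])"
proof -
  define ext where "ext v \<longleftrightarrow> (\<forall>n. \<exists>u\<in>words G n. bad (v @ u))" for v
  have step: "\<exists>e\<in>G. ext (v @ [e])" if "ext v" for v
  proof (rule ccontr)
    assume "\<not> ?thesis"
    then have "\<forall>e\<in>G. \<exists>n. \<forall>u\<in>words G n. \<not> bad (v @ [e] @ u)" by (auto simp: ext_def)
    then obtain N where N: "\<And>e u. e \<in> G \<Longrightarrow> u \<in> words G (N e) \<Longrightarrow> \<not> bad (v @ [e] @ u)"
      by metis
    obtain M where M: "\<And>e. e \<in> G \<Longrightarrow> N e \<le> M"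
      using finite_nat_set_iff_bounded_le[of "N ` G"] \<open>finite G\<close> by auto
    obtain u where u: "u \<in> words G (Suc M)" "bad (v @ u)" using \<open>ext v\<close> ext_def by blast
    then obtain e u' where u': "u = e # u'" "e \<in> G" "set u' \<subseteq> G" "length u' = M"
      by (cases u) (auto simp: words_def)
    have "take (N e) u' \<in> words G (N e)"
      using u' M[of e] set_take_subset[of "N e" u'] by (auto simp: words_def)
    moreover have "bad (v @ [e] @ take (N e) u')"
      using u(2) prefix[of "v @ [e] @ take (N e) u'" "drop (N e) u'"] u'(1) by simp
    ultimately show False using N u'(2) by blast
  qed
  have "\<exists>f. \<forall>n. (ext (f n) \<and> f n \<in> words G n) \<and> (\<exists>e. f (Suc n) = f n @ [e])"
  proof (rule dependent_nat_choice)
    show "\<exists>v. ext v \<and> v \<in> words G 0"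
      using bad by (intro exI[of _ "[]"]) (auto simp: ext_def words_def)
    show "\<exists>v'. (ext v' \<and> v' \<in> words G (Suc n)) \<and> (\<exists>e. v' = v @ [e])"
      if "ext v \<and> v \<in> words G n" for v n
      using step[of v] that by (fastforce simp: words_def)
  qed
  then obtain f where f: "\<And>n. ext (f n)" "\<And>n. f n \<in> words G n" "\<And>n. \<exists>e. f (Suc n) = f n @ [e]"
    by auto
  define \<omega> where "\<omega> n = last (f (Suc n))" for n
  have f_eq: "f n = map \<omega> [0..<n]" for n
  proof (induction n)
    case 0
    show ?case using f(2)[of 0] by (simp add: words_def)
  next
    case (Suc n)
    then show ?case using f(3)[of n] by (auto simp: \<omega>_def)
  qed
  show ?thesis
  proof (rule that[of \<omega>])
    show "\<omega> n \<in> G" for n using f(2)[of "Suc n"] by (auto simp: f_eq words_def)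
    show "bad (map \<omega> [0..<n])" for n
      using f(1)[of n] prefix[of "f n"] unfolding ext_def f_eq by blast
  qed
qed

text \<open>
  The part of Bowen's formula that bounds the dimension from below. If \<open>J G\<close> has covers by sets
  \<open>U\<^sub>i\<close> of small \<open>t\<close>-dimensional size, then the words whose image discs first become as small as a \<open>U\<^sub>i\<close>
  that they meet form a cut set \<open>V\<close> of the tree of words, and \<open>\<Sum>\<^sub>V\<close> of \<open>\<parallel>\<phi>\<^sub>v'\<parallel>\<^sup>t\<close> is at most \<open>1/2\<close>, because by
  separation only boundedly many words are attached to each \<open>U\<^sub>i\<close>. Splitting off an initial piece
  in \<open>V\<close> then bounds the sum over all words.
\<close>

lemma partition_sums_bounded:
  assumes G: "finite G" "G \<subseteq> cf_alphabet" and "0 < t" and dim: "hausdorff_dim (J G) < ennreal t"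
  obtains C where "\<And>n z. z \<in> cf_domain \<Longrightarrow> (\<Sum>k<n. partition_sum G t k z) \<le> C"
proof -
  have digG: "1 \<le> Re e" if "e \<in> G" for e using that G cf_alphabet_Re by auto
  have dig: "digits w" if "set w \<subseteq> G" for w using that digG by auto
  \<comment> \<open>A lower bound for the derivatives of single digits, which controls how far the
    last digit of a cut word can overshoot. The inserted 1 keeps \<open>Min\<close> meaningful for
    empty G.\<close>
  obtain c where c: "0 < c" "\<And>d. d \<in> G \<Longrightarrow> c \<le> wder [d] (1/2)"
  proof
    let ?S = "insert 1 ((\<lambda>d. wder [d] (1/2)) ` G)"
    show "Min ?S \<le> wder [d] (1/2)" if "d \<in> G" for d using G(1) that by (intro Min_le) auto
    have "0 < wder [d] (1/2)" if "d \<in> G" for d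
      using digG[OF that] by (intro wder_pos half_in_cf_domain) simp
    then have "0 < x" if "x \<in> ?S" for x using that by (auto simp del: wder.simps)
    then show "0 < Min ?S" using G(1) by (subst Min_gr_iff) blast+
  qed
  \<comment> \<open>The packing bound for separation c r/8 and distance 9 r = (72/c)(c r/8);
    \<epsilon> is then chosen to make the sum over the cut set at most 1/2.\<close>
  define M where "M = (2 * real_of_int \<bar>\<lceil>2 * (72 / c)\<rceil>\<bar> + 1)\<^sup>2"
  have M: "0 < M" unfolding M_def by (intro zero_less_power) linarith
  define \<epsilon> where "\<epsilon> = min (1/2) (1 / (2 * 8 powr t * M))"
  have \<epsilon>: "0 < \<epsilon>" "\<epsilon> < 1" "8 powr t * M * \<epsilon> \<le> 1/2"
  proof -
    have p: "0 < 8 powr t * M" using M by simp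
    show "0 < \<epsilon>" "\<epsilon> < 1" using M by (simp_all add: \<epsilon>_def)
    have "8 powr t * M * \<epsilon> \<le> 8 powr t * M * (1 / (2 * 8 powr t * M))"
      unfolding \<epsilon>_def using p by (intro mult_left_mono) auto
    also have "\<dots> = 1/2" using M by simp
    finally show "8 powr t * M * \<epsilon> \<le> 1/2" .
  qed
  obtain U :: "nat \<Rightarrow> complex set" and r :: "nat \<Rightarrow> real"
    where cov: "J G \<subseteq> (\<Union>i. U i)" and r: "\<And>i. 0 < r i"
      and Ur: "\<And>i x y. x \<in> U i \<Longrightarrow> y \<in> U i \<Longrightarrow> dist x y \<le> r i"
      and sum_r: "\<And>I. finite I \<Longrightarrow> (\<Sum>i\<in>I. r i powr t) \<le> \<epsilon>"
    using covers_of_hausdorff_dim_less[OF dim \<epsilon>(1)] by metis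
  have r1: "r i < 1" for i
  proof -
    have "r i powr t \<le> \<epsilon>" using sum_r[of "{i}"] by simp
    then have "r i powr t < 1" using \<epsilon>(2) by simp
    moreover have "1 \<le> r i powr t" if "1 \<le> r i" using that \<open>0 < t\<close> by (simp add: ge_one_powr_ge_zero)
    ultimately show ?thesis by force
  qed
  \<comment> \<open>Along each branch only the first prefix with derivative at most
    \<open>r i\<close> qualifies, so no member of \<open>V i\<close> is a proper prefix of
    another.\<close>
  define V where "V i = {w. set w \<subseteq> G \<and> wder w (1/2) \<le> r i \<and> (\<forall>k<length w. r i < wder (take k w) (1/2)) \<and>
      wmap w ` cf_domain \<inter> U i \<noteq> {}}" for i
  have V_large: "c / 8 * r i \<le> wder w (1/2)" if w: "w \<in> V i" for w i
  proof (cases w rule: rev_cases)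
    case Nil
    then show ?thesis using w r1[of i] by (auto simp: V_def)
  next
    case (snoc v d)
    have vd: "digits v" "d \<in> G" using w dig snoc by (auto simp: V_def)
    have "\<forall>k<length w. r i < wder (take k w) (1/2)" using w by (simp add: V_def)
    from this[rule_format, of "length v"] have "r i < wder v (1/2)" by (simp add: snoc)
    also have "\<dots> \<le> 8 * wder v (cf_map d (1/2))"
      using vd digG half_in_cf_domain cf_map_in_cf_domain by (intro wder_distortion) auto
    finally have "c / 8 * r i \<le> c / 8 * (8 * wder v (cf_map d (1/2)))"
      using c(1) by (intro mult_left_mono) auto
    also have "\<dots> \<le> wder v (cf_map d (1/2)) * wder [d] (1/2)"
      using mult_right_mono[OF c(2)[OF vd(2)], of "wder v (cf_map d (1/2))"]
        wder_pos[OF vd(1) cf_map_in_cf_domain[OF digG[OF vd(2)] half_in_cf_domain]]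
      by (simp add: mult.commute del: wder.simps)
    also have "\<dots> = wder w (1/2)" by (simp add: snoc wder_append)
    finally show ?thesis .
  qed
  have card_V: "finite (V i) \<and> real (card (V i)) \<le> M" for i
  proof (cases "V i = {}")
    case False
    then obtain u where u: "u \<in> U i" by (auto simp: V_def)
    have \<rho>: "0 < c / 8 * r i" using c r by simp
    have near: "cmod (wmap w (1/2) - u) \<le> 72 / c * (c / 8 * r i)" if w: "w \<in> V i" for w
      proof -
        obtain x where x: "x \<in> cf_domain" "wmap w x \<in> U i" using w by (auto simp: V_def)
        have "cmod (wmap w (1/2) - wmap w x) \<le> 8 * wder w (1/2)"
          using w x dig half_in_cf_domain by (intro dist_wmap_le) (auto simp: V_def)
        moreover have "cmod (wmap w x - u) \<le> r i" using Ur[OF x(2) u] by (simp add: dist_norm)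
        moreover have "wder w (1/2) \<le> r i" using w by (simp add: V_def)
        moreover have "cmod (wmap w (1/2) - u) \<le> cmod (wmap w (1/2) - wmap w x) + cmod (wmap w x - u)"
          using norm_triangle_ineq[of "wmap w (1/2) - wmap w x" "wmap w x - u"] by simp
        ultimately have "cmod (wmap w (1/2) - u) \<le> 9 * r i" by linarith
        also have "9 * r i = 72 / c * (c / 8 * r i)" using c by simp
        finally show ?thesis .
      qed
    have sep: "c / 8 * r i \<le> cmod (wmap w (1/2) - wmap w' (1/2))"
      if w: "w \<in> V i" "w' \<in> V i" "w \<noteq> w'" for w w'
    proof -
      have no_prefix: "\<not> strict_prefix a b" if ab: "a \<in> V i" "b \<in> V i" for a b
      proof
        assume "strict_prefix a b"
        then have "length a < length b" "take (length a) b = a"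
          by (auto simp: strict_prefix_def prefix_def)
        then have "r i < wder a (1/2)" using ab(2) by (auto simp: V_def)
        then show False using ab(1) by (simp add: V_def)
      qed
      have "w \<parallel> w'" using no_prefix[OF w(1,2)] no_prefix[OF w(2,1)] w(3)
        by (auto simp: strict_prefix_def)
      then obtain v e u e' u' where dec: "w = v @ e # u" "w' = v @ e' # u'" "e \<noteq> e'"
        using parallel_decomp[of w w'] by metis
      have "(c / 8 * r i)\<^sup>2 \<le> wder w (1/2) * wder w' (1/2)"
        unfolding power2_eq_square using V_large w c r[of i] wder_pos[OF _ half_in_cf_domain] dig
        by (intro mult_mono) (auto simp: V_def less_imp_le)
      also have "\<dots> \<le> (cmod (wmap w (1/2) - wmap w' (1/2)))\<^sup>2"
        using w G by (intro wmap_half_separated[OF _ _ dec]) (auto simp: V_def)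
      finally show ?thesis by (rule power2_le_imp_le) simp
    qed
    show ?thesis
      unfolding M_def
      using card_separated_le[where p = "\<lambda>w. wmap w (1/2)", OF \<rho> near sep] by blast
  qed (use M in simp)
  \<comment> \<open>Otherwise some infinite word has no prefix in any \<open>V i\<close>; but its
    point lies in some \<open>U i\<close>, and its first prefix with derivative at most
    \<open>r i\<close> is in \<open>V i\<close>.\<close>
  have "\<exists>N. \<forall>w\<in>words G N. \<exists>v. prefix v w \<and> v \<in> (\<Union>i. V i)"
  proof (rule ccontr)
    assume "\<not> ?thesis"
    then have bad: "\<exists>w\<in>words G n. \<forall>v. prefix v w \<longrightarrow> v \<notin> (\<Union>i. V i)" for n by blast
    obtain \<omega> where \<omega>: "\<And>n. \<omega> n \<in> G" "\<And>n. \<forall>v. prefix v (map \<omega> [0..<n]) \<longrightarrow> v \<notin> (\<Union>i. V i)"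
      by (rule Koenig_words[where bad = "\<lambda>w. \<forall>v. prefix v w \<longrightarrow> v \<notin> (\<Union>i. V i)", OF G(1) bad])
        (use prefix_prefix in blast)+
    let ?x = "coding_map cf_map cf_domain \<omega>"
    let ?w = "\<lambda>n. map \<omega> [0..<n]"
    have "?x \<in> J G" using \<omega>(1) by (auto simp: limit_set_def)
    then obtain i where i: "?x \<in> U i" using cov by auto
    have "(\<lambda>n. 2 * (1/2) ^ n :: real) \<longlonglongrightarrow> 2 * 0"
      by (intro tendsto_mult tendsto_const LIMSEQ_power_zero) simp
    then have "eventually (\<lambda>n. 2 * (1/2) ^ n < r i) sequentially"
      using r[of i] by (intro order_tendstoD(2)[of _ 0]) auto
    then obtain n where "2 * (1/2) ^ n < r i" using eventually_happens by force
    then have "wder (?w n) (1/2) \<le> r i"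
      using wder_le[of "?w n", OF _ half_in_cf_domain] \<omega>(1) digG by force
    then have ex: "\<exists>n. wder (?w n) (1/2) \<le> r i" by blast
    define m where "m = (LEAST n. wder (?w n) (1/2) \<le> r i)"
    have "wder (?w m) (1/2) \<le> r i" unfolding m_def using ex by (rule LeastI_ex)
    moreover have "r i < wder (take k (?w m)) (1/2)" if "k < m" for k
    proof -
      have "\<not> wder (?w k) (1/2) \<le> r i" using that unfolding m_def by (rule not_less_Least)
      then show ?thesis using that by (simp add: take_map)
    qed
    moreover have "?x \<in> wmap (?w m) ` cf_domain"
      using coding_map_in_image \<omega>(1) digG by blast
    ultimately have "?w m \<in> V i" using i \<omega>(1) by (auto simp: V_def)
    then show False using \<omega>(2)[of m] by auto
  qed
  then obtain N where N: "\<And>w. w \<in> words G N \<Longrightarrow> \<exists>v. prefix v w \<and> v \<in> (\<Union>i. V i)" by blast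
  define B where "B n = {w. set w \<subseteq> G \<and> length w < n}" for n
  have finB: "finite (B n)" for n
    by (rule finite_subset[OF _ finite_lists_length_le[OF G(1), of n]]) (auto simp: B_def)
  define W where "W = (\<Union>i. V i) \<inter> B (Suc N)"
  have finW: "finite W" using finB by (simp add: W_def)
  \<comment> \<open>By distortion this bounds \<open>wder v z powr t\<close> for every z in the
    disc.\<close>
  define g where "g v = (8 * wder v (1/2)) powr t" for v
  have sum_W: "sum g W \<le> 1/2"
  proof -
    have "\<exists>i. v \<in> V i" if "v \<in> W" for v using that by (auto simp: W_def)
    then obtain idx where idx: "\<And>v. v \<in> W \<Longrightarrow> v \<in> V (idx v)" by metis
    have inner: "sum g {v \<in> W. idx v = i} \<le> 8 powr t * M * r i powr t" for i
    proof -
      have "sum g {v \<in> W. idx v = i} \<le> real (card {v \<in> W. idx v = i}) * (8 * r i) powr t"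
      proof (rule sum_bounded_above)
        fix v assume "v \<in> {v \<in> W. idx v = i}"
        then have "v \<in> V i" using idx by auto
        then show "g v \<le> (8 * r i) powr t"
          unfolding g_def V_def using \<open>0 < t\<close> wder_pos[OF dig half_in_cf_domain, of v]
          by (intro powr_mono2) auto
      qed
      also have "\<dots> \<le> M * (8 * r i) powr t"
      proof (intro mult_right_mono)
        show "real (card {v \<in> W. idx v = i}) \<le> M"
        proof -
          have "card {v \<in> W. idx v = i} \<le> card (V i)"
            using idx card_V[of i] by (intro card_mono) auto
          then show ?thesis using card_V[of i] by linarith
        qed
      qed simp
      also have "\<dots> = 8 powr t * M * r i powr t" using r[of i] by (simp add: powr_mult)
      finally show ?thesis .
    qed
    have "sum g W = (\<Sum>i\<in>idx ` W. sum g {v \<in> W. idx v = i})"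
      using finW by (intro sum.group[symmetric]) auto
    also have "\<dots> \<le> (\<Sum>i\<in>idx ` W. 8 powr t * M * r i powr t)" by (intro sum_mono inner)
    also have "\<dots> = 8 powr t * M * (\<Sum>i\<in>idx ` W. r i powr t)" by (simp add: sum_distrib_left)
    also have "\<dots> \<le> 8 powr t * M * \<epsilon>" using sum_r finW M by (intro mult_left_mono) auto
    also have "\<dots> \<le> 1/2" by (rule \<epsilon>)
    finally show ?thesis .
  qed
  have sums_B: "(\<Sum>k<n. partition_sum G t k z) = (\<Sum>w\<in>B n. wder w z powr t)" for n z
  proof -
    have "(\<Sum>w\<in>B n. wder w z powr t) = (\<Sum>k<n. \<Sum>w\<in>{w \<in> B n. length w = k}. wder w z powr t)"
      using finB by (intro sum.group[symmetric]) (auto simp: B_def)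
    also have "\<dots> = (\<Sum>k<n. partition_sum G t k z)"
      unfolding partition_sum_def by (intro sum.cong) (auto simp: B_def words_def)
    finally show ?thesis by simp
  qed
  show ?thesis
  proof (rule that[of "2 * real (card (B N))"])
    fix n z assume z: "z \<in> cf_domain"
    define Y where "Y n = (\<Sum>w\<in>B n. wder w z powr t)" for n
    \<comment> \<open>A word of length at least N starts with a cut word of length at most
      N.\<close>
    have cover: "B n \<subseteq> B N \<union> (\<lambda>(v, u). v @ u) ` (W \<times> B n)"
    proof
      fix w assume w: "w \<in> B n"
      show "w \<in> B N \<union> (\<lambda>(v, u). v @ u) ` (W \<times> B n)"
      proof (cases "length w < N")
        case False
        then have "take N w \<in> words G N" using w set_take_subset[of N w] by (auto simp: words_def B_def)
        then obtain v where v: "prefix v (take N w)" "v \<in> (\<Union>i. V i)" using N by blast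
        have "length v \<le> N" using prefix_length_le[OF v(1)] by simp
        moreover have "prefix v w" using v(1) take_is_prefix prefix_order.trans by blast
        then obtain u where u: "w = v @ u" by (auto simp: prefix_def)
        ultimately have "v \<in> W" "u \<in> B n" using v w by (auto simp: W_def B_def)
        then show ?thesis using u by (auto intro!: image_eqI[of _ _ "(v, u)"])
      qed (use w in \<open>auto simp: B_def\<close>)
    qed
    have le: "wder (v @ u) z powr t \<le> g v * wder u z powr t" if "v \<in> W" "u \<in> B n" for u v
    proof -
      have d: "digits v" "digits u" using that dig by (auto simp: W_def B_def)
      have "wder v (wmap u z) \<le> 8 * wder v (1/2)"
        using wder_distortion[OF d(1) wmap_in_cf_domain[OF d(2) z] half_in_cf_domain] .
      then show ?thesis
        unfolding g_def wder_append using wder_pos[OF d(2) z] wder_pos[OF d(1) wmap_in_cf_domain[OF d(2) z]]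
          \<open>0 < t\<close> by (subst powr_mult[symmetric]) (auto intro!: powr_mono2 mult_right_mono)
    qed
    have "Y n \<le> (\<Sum>w\<in>B N \<union> (\<lambda>(v, u). v @ u) ` (W \<times> B n). wder w z powr t)"
      unfolding Y_def using finB finW by (intro sum_mono2 cover) auto
    also have "\<dots> \<le> Y N + (\<Sum>w\<in>(\<lambda>(v, u). v @ u) ` (W \<times> B n). wder w z powr t)"
      unfolding Y_def using finB finW by (subst sum.union_inter[symmetric]) (auto intro!: sum_nonneg)
    also have "(\<Sum>w\<in>(\<lambda>(v, u). v @ u) ` (W \<times> B n). wder w z powr t) \<le>
        (\<Sum>(v, u)\<in>W \<times> B n. wder (v @ u) z powr t)"
      using finB finW sum_image_le[of "W \<times> B n" "\<lambda>w. wder w z powr t" "\<lambda>(v, u). v @ u"]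
      by (simp add: case_prod_unfold comp_def)
    also have "\<dots> \<le> (\<Sum>(v, u)\<in>W \<times> B n. g v * wder u z powr t)"
      using le by (intro sum_mono) auto
    also have "\<dots> = sum g W * Y n"
      by (simp add: Y_def sum_product sum.cartesian_product)
    also have "\<dots> \<le> 1/2 * Y n"
      by (intro mult_right_mono sum_W) (auto simp: Y_def intro: sum_nonneg)
    \<comment> \<open>From Y n \<le> Y N + Y n / 2, where Y n is a finite sum.\<close>
    finally have "Y n \<le> 2 * Y N" by simp
    also have "Y N \<le> real (card (B N)) * 1"
      unfolding Y_def
    proof (rule sum_bounded_above)
      fix w assume "w \<in> B N"
      then have "digits w" using dig by (auto simp: B_def)
      then show "wder w z powr t \<le> 1"
        using wder_le_1[OF _ z, of w] wder_pos[OF _ z, of w] \<open>0 < t\<close> powr_mono2[of t "wder w z" 1] by auto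
    qed
    finally show "(\<Sum>k<n. partition_sum G t k z) \<le> 2 * real (card (B N))"
      unfolding sums_B Y_def by simp
  qed
qed

subsection \<open>Transfer operators and Green's functions\<close>

lemma partition_sum_0 [simp]: "partition_sum G t 0 z = 1"
proof -
  have "words G 0 = {[]}" by (auto simp: words_def)
  then show ?thesis by (simp add: partition_sum_def)
qed

lemma wder_snoc_powr:
  assumes "digits w" "1 \<le> Re d" "z \<in> cf_domain"
  shows "wder (w @ [d]) z powr t = wder [d] z powr t * wder w (cf_map d z) powr t"
  using assms wder_pos[of w "cf_map d z"] wder_pos[of "[d]" z] cf_map_in_cf_domain
  by (simp add: wder_append powr_mult mult.commute del: wder.simps)

lemma sum_words_snoc:
  assumes "G \<subseteq> cf_alphabet" "1 \<le> Re d" "z \<in> cf_domain"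
  shows "wder [d] z powr t * partition_sum G t n (cf_map d z) = (\<Sum>w\<in>words G n. wder (w @ [d]) z powr t)"
  unfolding partition_sum_def sum_distrib_left
  using assms wder_snoc_powr words_digits by (intro sum.cong) auto

text \<open>Splits off the last digit, the one applied first to z; the right side is the transfer
  operator.\<close>

lemma partition_sum_Suc:
  assumes G: "finite G" "G \<subseteq> cf_alphabet" and z: "z \<in> cf_domain"
  shows "partition_sum G t (Suc n) z = (\<Sum>d\<in>G. wder [d] z powr t * partition_sum G t n (cf_map d z))"
proof -
  have eq: "words G (Suc n) = (\<lambda>(d, w). w @ [d]) ` (G \<times> words G n)"
  proof
    show "words G (Suc n) \<subseteq> (\<lambda>(d, w). w @ [d]) ` (G \<times> words G n)"
    proof
      fix w assume "w \<in> words G (Suc n)"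
      then obtain v d where "w = v @ [d]" "d \<in> G" "v \<in> words G n"
        by (cases w rule: rev_cases) (auto simp: words_def)
      then show "w \<in> (\<lambda>(d, w). w @ [d]) ` (G \<times> words G n)" by force
    qed
  qed (auto simp: words_def)
  have "partition_sum G t (Suc n) z = (\<Sum>(d, w)\<in>G \<times> words G n. wder (w @ [d]) z powr t)"
    unfolding partition_sum_def eq
    by (subst sum.reindex) (auto simp: inj_on_def case_prod_unfold)
  also have "\<dots> = (\<Sum>d\<in>G. \<Sum>w\<in>words G n. wder (w @ [d]) z powr t)"
    by (simp add: sum.cartesian_product)
  also have "\<dots> = (\<Sum>d\<in>G. wder [d] z powr t * partition_sum G t n (cf_map d z))"
    using G z cf_alphabet_Re by (intro sum.cong refl sum_words_snoc[symmetric]) auto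
  finally show ?thesis .
qed

text \<open>The transfer operator is monotone, so its iterates on the constant a stay below f once a
  \<le> f.\<close>

lemma partition_sum_le_of_subinvariant:
  assumes G: "finite G" "G \<subseteq> cf_alphabet" and "0 < a" and f: "\<And>z. z \<in> cf_domain \<Longrightarrow> a \<le> f z"
    and sub: "\<And>z. z \<in> cf_domain \<Longrightarrow> (\<Sum>d\<in>G. wder [d] z powr t * f (cf_map d z)) \<le> f z"
    and "z \<in> cf_domain"
  shows "a * partition_sum G t n z \<le> f z"
  using \<open>z \<in> cf_domain\<close>
proof (induction n arbitrary: z)
  case (Suc n)
  have "a * partition_sum G t (Suc n) z = (\<Sum>d\<in>G. wder [d] z powr t * (a * partition_sum G t n (cf_map d z)))"
    by (simp add: partition_sum_Suc[OF G Suc.prems] sum_distrib_left mult_ac)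
  also have "\<dots> \<le> (\<Sum>d\<in>G. wder [d] z powr t * f (cf_map d z))"
    using Suc G cf_alphabet_Re by (intro sum_mono mult_left_mono Suc.IH cf_map_in_cf_domain) auto
  also have "\<dots> \<le> f z" by (rule sub[OF Suc.prems])
  finally show ?case .
qed (use f in auto)

lemma partition_sum_distortion:
  assumes "G \<subseteq> cf_alphabet" "0 < t" "x \<in> cf_domain" "y \<in> cf_domain"
  shows "partition_sum G t n x \<le> 8 powr t * partition_sum G t n y"
  unfolding partition_sum_def sum_distrib_left
proof (rule sum_mono)
  fix w assume "w \<in> words G n"
  then have w: "digits w" by (rule words_digits[OF assms(1)])
  have "wder w x powr t \<le> (8 * wder w y) powr t"
    using wder_distortion[OF w assms(3,4)] wder_pos[OF w assms(3)] assms(2) by (intro powr_mono2) auto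
  also have "\<dots> = 8 powr t * wder w y powr t"
    using wder_pos[OF w assms(4)] by (simp add: powr_mult)
  finally show "wder w x powr t \<le> 8 powr t * wder w y powr t" .
qed

text \<open>The Neumann series of the transfer operator applied to 1. Its \<open>suminf\<close> is
  meaningful only under summability, which for finite G follows from dimension below t.\<close>

definition green :: "complex set \<Rightarrow> real \<Rightarrow> complex \<Rightarrow> real" where
  "green G t z = (\<Sum>n. partition_sum G t n z)"

context
  fixes G t
  assumes G: "finite G" "G \<subseteq> cf_alphabet" and t: "0 < t" and dim: "hausdorff_dim (J G) < ennreal t"
begin

lemma summable_partition_sum:
  assumes "z \<in> cf_domain"
  shows "summable (\<lambda>n. partition_sum G t n z)"
proof -
  obtain C where C: "\<And>n z. z \<in> cf_domain \<Longrightarrow> (\<Sum>k<n. partition_sum G t k z) \<le> C"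
    using partition_sums_bounded[OF G t dim] by blast
  show ?thesis
    using C[OF assms, of "Suc _"] by (intro bounded_imp_summable[of _ C])
      (simp_all only: partition_sum_nonneg lessThan_Suc_atMost)
qed

text \<open>Applying the transfer operator shifts the series by one term. The surplus 1 later makes
  room for a further digit.\<close>

lemma green_eq:
  assumes "z \<in> cf_domain"
  shows "green G t z = 1 + (\<Sum>d\<in>G. wder [d] z powr t * green G t (cf_map d z))"
proof -
  have c: "cf_map d z \<in> cf_domain" if "d \<in> G" for d
    using that assms G cf_alphabet_Re by (auto intro: cf_map_in_cf_domain)
  have "green G t z = 1 + (\<Sum>n. partition_sum G t (Suc n) z)"
    unfolding green_def using suminf_split_head[OF summable_partition_sum[OF assms]] by simp
  also have "(\<Sum>n. partition_sum G t (Suc n) z) =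
      (\<Sum>d\<in>G. \<Sum>n. wder [d] z powr t * partition_sum G t n (cf_map d z))"
    unfolding partition_sum_Suc[OF G assms]
    by (intro suminf_sum summable_mult summable_partition_sum c)
  also have "\<dots> = (\<Sum>d\<in>G. wder [d] z powr t * green G t (cf_map d z))"
    unfolding green_def by (intro sum.cong refl suminf_mult summable_partition_sum c)
  finally show ?thesis .
qed

lemma green_nonneg: "z \<in> cf_domain \<Longrightarrow> 0 \<le> green G t z"
  unfolding green_def by (intro suminf_nonneg summable_partition_sum partition_sum_nonneg)

lemma green_ge_1: "z \<in> cf_domain \<Longrightarrow> 1 \<le> green G t z"
proof -
  assume z: "z \<in> cf_domain"
  have "0 \<le> (\<Sum>d\<in>G. wder [d] z powr t * green G t (cf_map d z))"
    using G cf_alphabet_Re z by (intro sum_nonneg mult_nonneg_nonneg green_nonneg cf_map_in_cf_domain) auto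
  then show ?thesis using green_eq[OF z] by linarith
qed

lemma green_distortion:
  assumes "x \<in> cf_domain" "y \<in> cf_domain"
  shows "green G t x \<le> 8 powr t * green G t y"
  unfolding green_def suminf_mult[OF summable_partition_sum[OF assms(2)], symmetric]
  by (intro suminf_le partition_sum_distortion[OF G(2) t assms] summable_mult
      summable_partition_sum assms)

text \<open>Green's function is subinvariant and varies by a factor of at most 8^t. The resulting
  bound depends on neither n nor G, which allows the passage to infinite alphabets.\<close>

lemma partition_sum_le:
  assumes z: "z \<in> cf_domain"
  shows "partition_sum G t n z \<le> 8 powr t"
proof -
  let ?f = "green G t"
  define a where "a = ?f z / 8 powr t"
  have "0 < a" using green_ge_1[OF z] by (simp add: a_def)
  have "a * partition_sum G t n z \<le> ?f z"
  proof (rule partition_sum_le_of_subinvariant[OF G \<open>0 < a\<close> _ _ z])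
    show "a \<le> ?f y" if "y \<in> cf_domain" for y
      using green_distortion[OF z that] by (simp add: a_def divide_le_eq mult.commute)
    show "(\<Sum>d\<in>G. wder [d] y powr t * ?f (cf_map d y)) \<le> ?f y" if "y \<in> cf_domain" for y
      using green_eq[OF that] by simp
  qed
  then show ?thesis using green_ge_1[OF z] by (simp add: a_def divide_le_eq)
qed

end

section \<open>Finite subsystems and the effect of adding one digit\<close>

lemma hausdorff_dim_J_le_of_finite:
  assumes F: "F \<subseteq> cf_alphabet" and "0 < t"
    and fin: "\<And>G. finite G \<Longrightarrow> G \<subseteq> F \<Longrightarrow> hausdorff_dim (J G) \<le> ennreal t"
  shows "hausdorff_dim (J F) \<le> ennreal t"
proof (rule ennreal_le_epsilon)
  fix e :: real assume "0 < e"
  have "hausdorff_dim (J F) \<le> ennreal (t + e)"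
  proof (rule hausdorff_dim_J_le[OF F])
    fix G n assume G: "finite G" "G \<subseteq> F"
    have "hausdorff_dim (J G) \<le> ennreal t" by (rule fin[OF G])
    also have "ennreal t < ennreal (t + e)" using \<open>0 < t\<close> \<open>0 < e\<close> by (intro ennreal_lessI) auto
    finally show "partition_sum G (t + e) n (1/2) \<le> 8 powr (t + e)"
      using G F \<open>0 < t\<close> \<open>0 < e\<close> half_in_cf_domain by (intro partition_sum_le) auto
  qed (use \<open>0 < t\<close> \<open>0 < e\<close> in simp)
  then show "hausdorff_dim (J F) \<le> ennreal t + ennreal e" using \<open>0 < t\<close> \<open>0 < e\<close> by simp
qed

text \<open>Let s1 < s2 lie between the dimension and t. Partition sums of finite subsystems are
  uniformly bounded at s1, hence decay geometrically at s2, and their Green's functions at s2 share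
  a bound C. A digit whose derivative to the power s2 is at most 1/C fits into the surplus 1 of
  Green's function.\<close>

lemma hausdorff_dim_J_insert_less:
  assumes F: "F \<subseteq> cf_alphabet" and dim: "hausdorff_dim (J F) < ennreal t"
  obtains R where "\<And>e. e \<in> cf_alphabet \<Longrightarrow> R \<le> cmod e \<Longrightarrow> hausdorff_dim (J (insert e F)) < ennreal t"
proof -
  obtain d where d: "hausdorff_dim (J F) = ennreal d" "0 \<le> d"
    using dim by (cases "hausdorff_dim (J F)") auto
  then have "d < t" using dim by (simp add: ennreal_less_iff)
  define s1 where "s1 = (2 * d + t) / 3"
  define s2 where "s2 = (d + 2 * t) / 3"
  have s: "d < s1" "s1 < s2" "s2 < t" "0 < s1" using d \<open>d < t\<close> by (auto simp: s1_def s2_def)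
  have dim_G: "hausdorff_dim (J G) < ennreal s1" "hausdorff_dim (J G) < ennreal s2" if "G \<subseteq> F" for G
  proof -
    have "hausdorff_dim (J G) \<le> ennreal d" using hausdorff_dim_J_mono[OF that] d by simp
    also have "ennreal d < ennreal s1" using d s by (intro ennreal_lessI) auto
    finally show "hausdorff_dim (J G) < ennreal s1" .
    also have "ennreal s1 < ennreal s2" using d s by (intro ennreal_lessI) auto
    finally show "hausdorff_dim (J G) < ennreal s2" .
  qed
  define q :: real where "q = (1/2) powr (s2 - s1)"
  define A :: real where "A = 8 powr s1 * 2 powr (s2 - s1)"
  have q: "0 < q" "q < 1"
    using powr_less_mono2[of "s2 - s1" "1/2" 1] s by (auto simp: q_def)
  define C where "C = max 1 (A * (1 / (1 - q)))"
  have C: "1 \<le> C" by (simp add: C_def)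
  have green_le: "green G s2 z \<le> C" if G: "finite G" "G \<subseteq> F" and z: "z \<in> cf_domain" for G z
  proof -
    have GE: "G \<subseteq> cf_alphabet" using G F by auto
    have le: "partition_sum G s2 n z \<le> A * q ^ n" for n
    proof -
      have "partition_sum G s2 n z \<le> (\<Sum>w\<in>words G n. (2 * (1/2) ^ n) powr (s2 - s1) * wder w z powr s1)"
        unfolding partition_sum_def
      proof (rule sum_mono)
        fix w assume w: "w \<in> words G n"
        have dw: "digits w" using words_digits[OF GE w] .
        have "wder w z powr s2 = wder w z powr (s2 - s1) * wder w z powr s1"
          by (simp add: powr_add[symmetric])
        also have "\<dots> \<le> (2 * (1/2) ^ n) powr (s2 - s1) * wder w z powr s1"
          using wder_le[OF dw z] wder_pos[OF dw z] w s
          by (intro mult_right_mono powr_mono2) (auto simp: words_def)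
        finally show "wder w z powr s2 \<le> (2 * (1/2) ^ n) powr (s2 - s1) * wder w z powr s1" .
      qed
      also have "\<dots> = (2 * (1/2) ^ n) powr (s2 - s1) * partition_sum G s1 n z"
        by (simp add: partition_sum_def sum_distrib_left)
      also have "\<dots> \<le> (2 * (1/2) ^ n) powr (s2 - s1) * 8 powr s1"
        using partition_sum_le[OF G(1) GE s(4) dim_G(1)[OF G(2)] z] by (intro mult_left_mono) auto
      also have "(2 * (1/2) ^ n) powr (s2 - s1) = 2 powr (s2 - s1) * q ^ n"
      proof -
        have "((1/2::real) ^ n) powr (s2 - s1) = (1/2) powr (real n * (s2 - s1))"
          by (simp only: powr_realpow[symmetric, of "1/2::real"] powr_powr)
        also have "\<dots> = q ^ n" by (simp add: q_def powr_power)
        finally show ?thesis by (simp add: powr_mult)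
      qed
      also have "2 powr (s2 - s1) * q ^ n * 8 powr s1 = A * q ^ n" by (simp add: A_def)
      finally show ?thesis .
    qed
    have sq: "(\<lambda>n. A * q ^ n) sums (A * (1 / (1 - q)))"
      using q by (intro sums_mult geometric_sums) auto
    have "0 < s2" using s by simp
    then have "green G s2 z \<le> (\<Sum>n. A * q ^ n)"
      unfolding green_def
      by (intro suminf_le le summable_partition_sum[OF G(1) GE _ dim_G(2)[OF G(2)] z] sums_summable[OF sq])
    also have "\<dots> = A * (1 / (1 - q))" using sq by (simp add: sums_iff)
    finally have "green G s2 z \<le> A * (1 / (1 - q))" .
    then show ?thesis by (simp add: C_def)
  qed
  \<comment> \<open>A derivative of at most 1/\<rho> has s2-th power at most 1/C; the threshold
    \<rho> + 1 for |e| allows for |z| \<le> 1.\<close>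
  define \<rho> where "\<rho> = C powr (1 / s2)"
  have \<rho>: "1 \<le> \<rho>" "\<rho> powr s2 = C" using C s by (auto simp: \<rho>_def ge_one_powr_ge_zero powr_powr)
  show ?thesis
  proof (rule that[of "\<rho> + 1"])
    fix e assume e: "e \<in> cf_alphabet" "\<rho> + 1 \<le> cmod e"
    have small: "wder [e] z powr s2 * C \<le> 1" if z: "z \<in> cf_domain" for z
    proof -
      have "cmod z \<le> 1" using cf_domain_dist[OF z zero_in_cf_domain] by simp
      then have "\<rho> \<le> cmod (e + z)" using e(2) norm_diff_ineq[of e z] by linarith
      also have "\<dots> \<le> (cmod (e + z))\<^sup>2"
        using \<open>\<rho> \<le> cmod (e + z)\<close> \<rho>(1) self_le_power[of "cmod (e + z)" 2] by auto
      finally have "wder [e] z \<le> 1 / \<rho>" using \<rho>(1) by (simp add: frac_le)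
      then have "wder [e] z powr s2 \<le> (1 / \<rho>) powr s2" using s by (intro powr_mono2) auto
      also have "\<dots> = 1 / C" using \<rho> by (simp add: powr_divide)
      finally show ?thesis using C by (simp add: le_divide_eq)
    qed
    have "hausdorff_dim (J (insert e F)) \<le> ennreal s2"
    proof (rule hausdorff_dim_J_le)
      show "insert e F \<subseteq> cf_alphabet" using e F by simp
      show "0 < s2" using s by simp
      fix H n assume H: "finite H" "H \<subseteq> insert e F"
      let ?G = "H - {e}" let ?f = "green ?G s2"
      have G: "finite ?G" "?G \<subseteq> F" "?G \<subseteq> cf_alphabet" using H F by auto
      note gr = green_eq[OF G(1,3) \<open>0 < s2\<close> dim_G(2)[OF G(2)]]
        green_ge_1[OF G(1,3) \<open>0 < s2\<close> dim_G(2)[OF G(2)]]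
      have "1 * partition_sum H s2 n (1/2) \<le> ?f (1/2)"
      proof (rule partition_sum_le_of_subinvariant[OF H(1) _ _ gr(2) _ half_in_cf_domain])
        show "H \<subseteq> cf_alphabet" using H e F by auto
        fix z assume z: "z \<in> cf_domain"
        have ez: "cf_map e z \<in> cf_domain" using cf_map_in_cf_domain cf_alphabet_Re e z by auto
        have "(\<Sum>d\<in>H. wder [d] z powr s2 * ?f (cf_map d z)) \<le>
            (\<Sum>d\<in>insert e ?G. wder [d] z powr s2 * ?f (cf_map d z))"
        proof (rule sum_mono2)
          fix d assume "d \<in> insert e ?G - H"
          then have "d = e" by auto
          then show "0 \<le> wder [d] z powr s2 * ?f (cf_map d z)" using gr(2)[OF ez] by auto
        qed (use H in auto)
        also have "\<dots> = wder [e] z powr s2 * ?f (cf_map e z) + (\<Sum>d\<in>?G. wder [d] z powr s2 * ?f (cf_map d z))"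
          using G(1) by (subst sum.insert) auto
        also have "wder [e] z powr s2 * ?f (cf_map e z) \<le> wder [e] z powr s2 * C"
          by (intro mult_left_mono green_le G ez) auto
        also have "wder [e] z powr s2 * C \<le> 1" by (rule small[OF z])
        finally show "(\<Sum>d\<in>H. wder [d] z powr s2 * ?f (cf_map d z)) \<le> ?f z"
          using gr(1)[OF z] by linarith
      qed simp
      also have "?f (1/2) \<le> C" by (intro green_le G half_in_cf_domain)
      finally show "partition_sum H s2 n (1/2) \<le> C" by simp
    qed
    also have "ennreal s2 < ennreal t" using s by (intro ennreal_lessI) auto
    finally show "hausdorff_dim (J (insert e F)) < ennreal t" .
  qed
qed

text \<open>
  The comparison that drives the greedy algorithm: trading the digit \<open>e\<close> for the digits in \<open>D\<close> does not
  decrease the dimension. Green's function of \<open>G \<union> D\<close> is a sum of functions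
  \<open>\<lambda> / \<bar>1 + \<kappa>z\<bar>\<^sup>2\<^sup>t\<close>; on such a function the hypothesis says that the transfer operator of \<open>D\<close> dominates
  the one of \<open>e\<close>, with \<open>\<zeta> = z + \<kappa>\<close>.
\<close>

lemma hausdorff_dim_J_exchange:
  assumes G: "finite G" "G \<subseteq> cf_alphabet" and D: "finite D" "D \<subseteq> cf_alphabet" "G \<inter> D = {}"
    and e: "e \<in> cf_alphabet" and "0 < t"
    and dom: "\<And>\<zeta>. \<zeta> \<in> cball 1 1 \<Longrightarrow> 1 \<le> (\<Sum>d\<in>D. ((cmod (e + \<zeta>))\<^sup>2 / (cmod (d + \<zeta>))\<^sup>2) powr t)"
    and dim: "hausdorff_dim (J (G \<union> D)) < ennreal t"
  shows "hausdorff_dim (J (insert e G)) \<le> ennreal t"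
proof -
  let ?A = "G \<union> D"
  let ?f = "green ?A t"
  have A: "finite ?A" "?A \<subseteq> cf_alphabet" using G D by auto
  note smm = summable_partition_sum[OF A \<open>0 < t\<close> dim]
  have cf: "cf_map d z \<in> cf_domain" if "d \<in> cf_alphabet" "z \<in> cf_domain" for d z
    using cf_map_in_cf_domain cf_alphabet_Re that by auto
  have word: "wder (w @ [e]) z powr t \<le> (\<Sum>d\<in>D. wder (w @ [d]) z powr t)"
    if w: "digits w" and z: "z \<in> cf_domain" for w z
  proof -
    obtain l \<kappa> where l: "0 < l" "\<kappa> \<in> cf_domain"
      "\<And>d z. 1 \<le> Re d \<Longrightarrow> z \<in> cf_domain \<Longrightarrow> wder (w @ [d]) z = l / (cmod (d + (z + \<kappa>)))\<^sup>2"
      using wder_form[OF w] by metis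
    let ?\<zeta> = "z + \<kappa>"
    \<comment> \<open>A sum of two points of the disc with centre and radius 1/2 lies in the disc
      with centre and radius 1.\<close>
    have "1 - ?\<zeta> = (1/2 - z) + (1/2 - \<kappa>)" by (simp add: algebra_simps)
    then have "cmod (1 - ?\<zeta>) \<le> cmod (1/2 - z) + cmod (1/2 - \<kappa>)"
      by (simp only: norm_triangle_ineq)
    then have "?\<zeta> \<in> cball 1 1" using z l(2) by (simp add: cf_domain_def dist_norm)
    then have "wder (w @ [e]) z powr t * 1 \<le> wder (w @ [e]) z powr t *
        (\<Sum>d\<in>D. ((cmod (e + ?\<zeta>))\<^sup>2 / (cmod (d + ?\<zeta>))\<^sup>2) powr t)"
      by (intro mult_left_mono dom) auto
    also have "\<dots> = (\<Sum>d\<in>D. wder (w @ [d]) z powr t)"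
      unfolding sum_distrib_left
    proof (rule sum.cong[OF refl])
      fix d assume "d \<in> D"
      then have Re: "1 \<le> Re d" "1 \<le> Re e" using D e cf_alphabet_Re by auto
      have "0 < wder (w @ [e]) z" using w Re z by (intro wder_pos) auto
      then have "e + ?\<zeta> \<noteq> 0" using l(3)[OF Re(2) z] by auto
      then have eq: "wder (w @ [d]) z = wder (w @ [e]) z * ((cmod (e + ?\<zeta>))\<^sup>2 / (cmod (d + ?\<zeta>))\<^sup>2)"
        by (simp add: l(3) Re z del: wder.simps)
      show "wder (w @ [e]) z powr t * ((cmod (e + ?\<zeta>))\<^sup>2 / (cmod (d + ?\<zeta>))\<^sup>2) powr t =
          wder (w @ [d]) z powr t"
        unfolding eq by (rule powr_mult[symmetric])
    qed
    finally show ?thesis by simp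
  qed
  have level: "wder [e] z powr t * partition_sum ?A t n (cf_map e z) \<le>
      (\<Sum>d\<in>D. wder [d] z powr t * partition_sum ?A t n (cf_map d z))" if z: "z \<in> cf_domain" for z n
  proof -
    have "wder [e] z powr t * partition_sum ?A t n (cf_map e z) = (\<Sum>w\<in>words ?A n. wder (w @ [e]) z powr t)"
      using e cf_alphabet_Re by (intro sum_words_snoc[OF A(2) _ z]) auto
    also have "\<dots> \<le> (\<Sum>w\<in>words ?A n. \<Sum>d\<in>D. wder (w @ [d]) z powr t)"
      by (intro sum_mono word z words_digits[OF A(2)])
    also have "\<dots> = (\<Sum>d\<in>D. \<Sum>w\<in>words ?A n. wder (w @ [d]) z powr t)" by (rule sum.swap)
    also have "\<dots> = (\<Sum>d\<in>D. wder [d] z powr t * partition_sum ?A t n (cf_map d z))"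
      using D cf_alphabet_Re by (intro sum.cong refl sum_words_snoc[OF A(2) _ z, symmetric]) auto
    finally show ?thesis .
  qed
  have exch: "wder [e] z powr t * ?f (cf_map e z) \<le> (\<Sum>d\<in>D. wder [d] z powr t * ?f (cf_map d z))"
    if z: "z \<in> cf_domain" for z
  proof -
    have sD: "summable (\<lambda>n. wder [d] z powr t * partition_sum ?A t n (cf_map d z))" if "d \<in> D" for d
      using that D z by (intro summable_mult smm cf) auto
    have "wder [e] z powr t * ?f (cf_map e z) = (\<Sum>n. wder [e] z powr t * partition_sum ?A t n (cf_map e z))"
      unfolding green_def by (intro suminf_mult[symmetric] smm cf e z)
    also have "\<dots> \<le> (\<Sum>n. \<Sum>d\<in>D. wder [d] z powr t * partition_sum ?A t n (cf_map d z))"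
      by (intro suminf_le level[OF z] summable_mult smm cf e z summable_sum sD)
    also have "\<dots> = (\<Sum>d\<in>D. \<Sum>n. wder [d] z powr t * partition_sum ?A t n (cf_map d z))"
      by (intro suminf_sum sD)
    also have "\<dots> = (\<Sum>d\<in>D. wder [d] z powr t * ?f (cf_map d z))"
      unfolding green_def using D z by (intro sum.cong refl suminf_mult smm cf) auto
    finally show ?thesis .
  qed
  show ?thesis
  proof (rule hausdorff_dim_J_le[OF _ \<open>0 < t\<close>])
    show "insert e G \<subseteq> cf_alphabet" using e G by simp
    fix H n assume H: "finite H" "H \<subseteq> insert e G"
    have "1 * partition_sum H t n (1/2) \<le> ?f (1/2)"
    proof (rule partition_sum_le_of_subinvariant[OF H(1) _ _ green_ge_1[OF A \<open>0 < t\<close> dim] _ half_in_cf_domain])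
      show "H \<subseteq> cf_alphabet" using H e G by auto
      fix z assume z: "z \<in> cf_domain"
      have pos: "0 \<le> wder [d] z powr t * ?f (cf_map d z)" if "d \<in> cf_alphabet" for d
        using green_nonneg[OF A \<open>0 < t\<close> dim cf[OF that z]] by simp
      have "(\<Sum>d\<in>H. wder [d] z powr t * ?f (cf_map d z)) \<le> (\<Sum>d\<in>insert e G. wder [d] z powr t * ?f (cf_map d z))"
        using H G e by (intro sum_mono2 pos) auto
      \<comment> \<open>Only an inequality, since e may already belong to G and is then counted
        twice.\<close>
      also have "\<dots> \<le> wder [e] z powr t * ?f (cf_map e z) + (\<Sum>d\<in>G. wder [d] z powr t * ?f (cf_map d z))"
        using G(1) pos[OF e] by (cases "e \<in> G") (auto simp: insert_absorb simp del: wder.simps)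
      also have "\<dots> \<le> (\<Sum>d\<in>D. wder [d] z powr t * ?f (cf_map d z)) + (\<Sum>d\<in>G. wder [d] z powr t * ?f (cf_map d z))"
        using exch[OF z] by simp
      also have "\<dots> = (\<Sum>d\<in>?A. wder [d] z powr t * ?f (cf_map d z))"
        using G D by (simp add: sum.union_disjoint del: wder.simps)
      also have "\<dots> \<le> ?f z" using green_eq[OF A \<open>0 < t\<close> dim z] by simp
      finally show "(\<Sum>d\<in>H. wder [d] z powr t * ?f (cf_map d z)) \<le> ?f z" .
    qed simp
    then show "partition_sum H t n (1/2) \<le> ?f (1/2)" by simp
  qed
qed

subsection \<open>Domination of a digit by later digits\<close>

text \<open>The tangent to 1/b^2 at b = c; the difference is (c - b)^2 (c + 2b) / (b^2 c^3).\<close>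

lemma tangent_2:
  fixes b c :: real
  assumes "0 < b" "0 < c"
  shows "3 / c\<^sup>2 - 2 / c ^ 3 * b \<le> (1 / b) powr 2"
proof -
  have "0 \<le> (c - b)\<^sup>2 * (c + 2 * b)" using assms by simp
  then have "3 * c * b\<^sup>2 - 2 * b ^ 3 \<le> c ^ 3"
    by (simp add: power2_eq_square power3_eq_cube algebra_simps)
  then have "(3 * c * b\<^sup>2 - 2 * b ^ 3) / (b\<^sup>2 * c ^ 3) \<le> c ^ 3 / (b\<^sup>2 * c ^ 3)"
    using assms by (intro divide_right_mono) auto
  moreover have "(3 * c * b\<^sup>2 - 2 * b ^ 3) / (b\<^sup>2 * c ^ 3) = 3 / c\<^sup>2 - 2 / c ^ 3 * b"
    using assms by (simp add: field_simps power2_eq_square power3_eq_cube)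
  moreover have "c ^ 3 / (b\<^sup>2 * c ^ 3) = (1 / b) powr 2"
    using assms by (simp add: power_divide)
  ultimately show ?thesis by simp
qed

text \<open>The tangent to b^(-3/2) at b = s^2. In terms of r = sqrt b the difference is rational,
  with a double zero at r = s.\<close>

lemma tangent_3_2:
  fixes b s :: real
  assumes "0 < b" "0 < s"
  shows "5 / 2 / s ^ 3 - 3 / 2 / s ^ 5 * b \<le> (1 / b) powr (3/2)"
proof -
  define r where "r = sqrt b"
  have r: "0 < r" "b = r\<^sup>2" using assms by (auto simp: r_def)
  have "0 \<le> (s - r)\<^sup>2 * (2 * s ^ 3 + 4 * s\<^sup>2 * r + 6 * s * r\<^sup>2 + 3 * r ^ 3)"
    using assms r by (intro mult_nonneg_nonneg) auto
  then have "5 * s\<^sup>2 * r ^ 3 - 3 * r ^ 5 \<le> 2 * s ^ 5"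
    by (simp add: power2_eq_square eval_nat_numeral algebra_simps)
  then have "(5 * s\<^sup>2 * r ^ 3 - 3 * r ^ 5) / (2 * s ^ 5 * r ^ 3) \<le> 2 * s ^ 5 / (2 * s ^ 5 * r ^ 3)"
    using assms r by (intro divide_right_mono) auto
  moreover have "(5 * s\<^sup>2 * r ^ 3 - 3 * r ^ 5) / (2 * s ^ 5 * r ^ 3) = 5 / 2 / s ^ 3 - 3 / 2 / s ^ 5 * b"
    using assms r by (simp add: field_simps eval_nat_numeral)
  moreover have "2 * s ^ 5 / (2 * s ^ 5 * r ^ 3) = (1 / b) powr (3/2)"
  proof -
    have "b powr (3/2) = (r powr 2) powr (3/2)" using r by simp
    also have "\<dots> = r powr 3" by (simp only: powr_powr) simp
    also have "\<dots> = r ^ 3" using r by simp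
    finally show ?thesis using assms by (simp add: powr_divide)
  qed
  ultimately show ?thesis by simp
qed

text \<open>Reduces domination to the largest exponent: a term that is at least 1 suffices alone,
  and terms below 1 do not shrink as the exponent decreases.\<close>

lemma sum_powr_ge_1:
  fixes a :: "'i \<Rightarrow> real"
  assumes "finite D" "\<And>d. d \<in> D \<Longrightarrow> 0 \<le> a d" "0 \<le> t" "t \<le> T" "1 \<le> (\<Sum>d\<in>D. a d powr T)"
  shows "1 \<le> (\<Sum>d\<in>D. a d powr t)"
proof (cases "\<exists>d\<in>D. 1 \<le> a d")
  case True
  then obtain d where "d \<in> D" "1 \<le> a d" by auto
  then have "1 \<le> a d powr t" using assms(3) by (simp add: ge_one_powr_ge_zero)
  also have "\<dots> \<le> (\<Sum>d\<in>D. a d powr t)" using assms(1) \<open>d \<in> D\<close> by (intro member_le_sum) auto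
  finally show ?thesis .
next
  case False
  have "(\<Sum>d\<in>D. a d powr T) \<le> (\<Sum>d\<in>D. a d powr t)"
    using False assms by (intro sum_mono powr_mono') (auto simp: not_le less_imp_le)
  then show ?thesis using assms(5) by linarith
qed

text \<open>
  Bounding each term from below by a tangent of the convex function \<open>b \<mapsto> b\<^sup>-\<^sup>T\<close> turns the domination
  condition into a quadratic inequality on a disc. The offsets are reflected by \<open>\<sigma>\<close> so that only
  digits in the upper half plane have to be considered.
\<close>

lemma domination_of_offsets:
  fixes e :: complex and \<sigma> :: int and O' :: "(int \<times> int) set" and \<alpha> \<beta> :: "int \<times> int \<Rightarrow> real"
  assumes e: "1 \<le> Re e" and \<sigma>: "\<sigma> = 1 \<or> \<sigma> = -1" and t: "0 \<le> t" "t \<le> T"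
    and O': "finite O'" "\<And>p q. (p, q) \<in> O' \<Longrightarrow> 0 \<le> p"
    and tangent: "\<And>o' b. o' \<in> O' \<Longrightarrow> 0 < b \<Longrightarrow> \<alpha> o' - \<beta> o' * b \<le> (1 / b) powr T"
    and quad: "\<And>x y :: real. (x - (Re e + 1))\<^sup>2 + (y - real_of_int \<sigma> * Im e)\<^sup>2 \<le> 1 \<Longrightarrow>
      (\<Sum>(p, q)\<in>O'. \<beta> (p, q) * ((x + real_of_int p)\<^sup>2 + (y + real_of_int q)\<^sup>2)) \<le> ((\<Sum>o'\<in>O'. \<alpha> o') - 1) * (x\<^sup>2 + y\<^sup>2)"
    and \<zeta>: "\<zeta> \<in> cball 1 1"
  shows "1 \<le> (\<Sum>d\<in>(\<lambda>(p, q). e + of_int p + of_int (\<sigma> * q) * \<i>) ` O'.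
    ((cmod (e + \<zeta>))\<^sup>2 / (cmod (d + \<zeta>))\<^sup>2) powr t)"
proof -
  \<comment> \<open>In these coordinates, reflected if \<sigma> = -1, A is |e + \<zeta>|^2 and B is
    |d + \<zeta>|^2; the tangents are applied at b = B/A.\<close>
  define x where "x = Re (e + \<zeta>)"
  define y where "y = \<sigma> * Im (e + \<zeta>)"
  define A where "A = x\<^sup>2 + y\<^sup>2"
  define B where "B = (\<lambda>(p::int, q::int). (x + p)\<^sup>2 + (y + q)\<^sup>2)"
  have \<sigma>2: "real_of_int \<sigma> * real_of_int \<sigma> = 1" using \<sigma> by auto
  have z: "(cmod (1 - \<zeta>))\<^sup>2 \<le> 1" using \<zeta> by (simp add: dist_norm power_le_one)
  have "0 \<le> Re \<zeta>" using \<zeta> complex_Re_le_cmod[of "1 - \<zeta>"] by (simp add: dist_norm)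
  then have x: "1 \<le> x" using e by (simp add: x_def)
  have A: "0 < A" using x by (simp add: A_def add_pos_nonneg)
  have B: "0 < B o'" if "o' \<in> O'" for o'
  proof -
    obtain p q where "o' = (p, q)" by force
    then have "0 < x + p" using O'(2)[of p q] that x by simp
    then have "0 < (x + p)\<^sup>2 + (y + q)\<^sup>2" by (simp add: add_pos_nonneg)
    then show ?thesis by (simp add: B_def \<open>o' = (p, q)\<close>)
  qed
  have A_eq: "(cmod (e + \<zeta>))\<^sup>2 = A"
  proof -
    have "y\<^sup>2 = (\<sigma> * \<sigma>) * (Im (e + \<zeta>))\<^sup>2" by (simp add: y_def power2_eq_square)
    then show ?thesis by (simp add: A_def x_def cmod_power2 \<sigma>2)
  qed
  have B_eq: "(cmod (e + of_int p + of_int (\<sigma> * q) * \<i> + \<zeta>))\<^sup>2 = B (p, q)" for p q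
  proof -
    have "(y + q)\<^sup>2 = (\<sigma> * \<sigma>) * (Im (e + \<zeta>))\<^sup>2 + 2 * \<sigma> * q * Im (e + \<zeta>) + q\<^sup>2"
      by (simp add: y_def power2_eq_square algebra_simps)
    also have "\<dots> = (Im (e + \<zeta>))\<^sup>2 + 2 * \<sigma> * q * Im (e + \<zeta>) + (\<sigma> * \<sigma>) * q\<^sup>2"
      by (simp add: \<sigma>2)
    also have "\<dots> = (Im (e + \<zeta>) + \<sigma> * q)\<^sup>2" by (simp add: power2_eq_square algebra_simps)
    finally show ?thesis by (simp add: B_def x_def cmod_power2 add_ac)
  qed
  have inj: "inj_on (\<lambda>(p, q). e + of_int p + of_int (\<sigma> * q) * \<i>) O'"
    using \<sigma> by (auto simp: inj_on_def complex_eq_iff)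
  have "(x - (Re e + 1))\<^sup>2 + (y - \<sigma> * Im e)\<^sup>2 \<le> 1"
  proof -
    have "(y - \<sigma> * Im e)\<^sup>2 = (\<sigma> * \<sigma>) * (Im \<zeta>)\<^sup>2" by (simp add: y_def power2_eq_square algebra_simps)
    then have "(y - \<sigma> * Im e)\<^sup>2 = (Im \<zeta>)\<^sup>2" by (simp add: \<sigma>2)
    then show ?thesis using z by (simp add: x_def cmod_power2 power2_commute)
  qed
  from quad[OF this] have "(\<Sum>o'\<in>O'. \<beta> o' * B o') \<le> ((\<Sum>o'\<in>O'. \<alpha> o') - 1) * A"
    by (simp add: A_def B_def case_prod_unfold)
  then have "1 \<le> (\<Sum>o'\<in>O'. \<alpha> o') - (\<Sum>o'\<in>O'. \<beta> o' * B o') / A"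
    using A by (simp add: field_simps)
  also have "\<dots> = (\<Sum>o'\<in>O'. \<alpha> o' - \<beta> o' * (B o' / A))"
    by (simp add: sum_subtractf sum_divide_distrib)
  also have "\<dots> \<le> (\<Sum>o'\<in>O'. (1 / (B o' / A)) powr T)"
    using A B by (intro sum_mono tangent) auto
  also have "\<dots> = (\<Sum>o'\<in>O'. (A / B o') powr T)" by simp
  finally have "1 \<le> (\<Sum>o'\<in>O'. (A / B o') powr T)" .
  then have "1 \<le> (\<Sum>o'\<in>O'. (A / B o') powr t)"
    using A B O'(1) t by (intro sum_powr_ge_1[of O' _ t T]) (auto simp: less_imp_le)
  also have "\<dots> = (\<Sum>d\<in>(\<lambda>(p, q). e + of_int p + of_int (\<sigma> * q) * \<i>) ` O'.
      ((cmod (e + \<zeta>))\<^sup>2 / (cmod (d + \<zeta>))\<^sup>2) powr t)"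
    unfolding sum.reindex[OF inj] by (intro sum.cong) (auto simp: A_eq B_eq simp del: of_int_mult)
  finally show ?thesis .
qed

section \<open>Integer coordinates and the order of the digits\<close>

definition digit :: "int \<Rightarrow> int \<Rightarrow> complex" where
  "digit m n = of_int m + of_int n * \<i>"

lemma digit_simps [simp]: "Re (digit m n) = m" "Im (digit m n) = n"
  by (simp_all add: digit_def)

lemma cf_alphabet_eq: "cf_alphabet = {digit m n | m n. 1 \<le> m}"
proof
  show "cf_alphabet \<subseteq> {digit m n | m n. 1 \<le> m}"
  proof
    fix e assume "e \<in> cf_alphabet"
    then obtain m :: nat and n where "e = of_nat m + of_int n * \<i>" "1 \<le> m"
      by (auto simp: cf_alphabet_def)
    then show "e \<in> {digit m n | m n. 1 \<le> m}"
      by (intro CollectI exI[of _ "int m"] exI[of _ n]) (simp add: digit_def)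
  qed
  show "{digit m n | m n. 1 \<le> m} \<subseteq> cf_alphabet"
  proof clarify
    fix m n :: int assume "1 \<le> m"
    then show "digit m n \<in> cf_alphabet"
      unfolding cf_alphabet_def by (auto simp: digit_def intro!: exI[of _ "nat m"] exI[of _ n])
  qed
qed

text \<open>
  Digits \<open>m + ni\<close> are ordered lexicographically by \<open>m + \<bar>n\<bar>\<close>, \<open>m\<close> and the sign of \<open>n\<close>. Along the edges of
  the diamonds \<open>m + \<bar>n\<bar> = s\<close> the order runs towards the real axis, which leaves enough digits
  close to \<open>m + ni\<close> for later.
\<close>

definition digit_key :: "complex \<Rightarrow> nat" where
  "digit_key e = (let m = nat \<lfloor>Re e\<rfloor>; n = \<lfloor>Im e\<rfloor>; s = m + nat \<bar>n\<bar>
     in 2 * (s * Suc s + m) + (if 0 \<le> n then 1 else 0))"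

text \<open>As m \<le> s, the number s(s+1) + m orders the pairs (s, m) lexicographically: the next
  block starts 2(s+1) later. Doubling leaves room for the sign bit.\<close>

lemma digit_key_less:
  assumes "1 \<le> m" "1 \<le> m'" "m + \<bar>n\<bar> < m' + \<bar>n'\<bar> \<or> m + \<bar>n\<bar> = m' + \<bar>n'\<bar> \<and> m < m'"
  shows "digit_key (digit m n) < digit_key (digit m' n')"
proof -
  define s where "s = nat m + nat \<bar>n\<bar>"
  define s' where "s' = nat m' + nat \<bar>n'\<bar>"
  have "int s = m + \<bar>n\<bar>" "int s' = m' + \<bar>n'\<bar>" using assms by (simp_all add: s_def s'_def)
  then have "s < s' \<or> s = s' \<and> nat m < nat m'" using assms by linarith
  moreover have "nat m \<le> s" by (simp add: s_def)
  moreover have "s * Suc s + nat m < s' * Suc s'" if "s < s'"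
  proof -
    have "Suc s * Suc (Suc s) \<le> s' * Suc s'" using that by (intro mult_le_mono) auto
    then show ?thesis using \<open>nat m \<le> s\<close> by simp
  qed
  ultimately have "s * Suc s + nat m < s' * Suc s' + nat m'" by fastforce
  then show ?thesis
    by (simp add: digit_key_def Let_def s_def[symmetric] s'_def[symmetric] del: mult_Suc_right)
qed

text \<open>Ensures that each step of the greedy algorithm decides about at most one digit.\<close>

lemma inj_on_digit_key: "inj_on digit_key cf_alphabet"
proof (rule inj_onI)
  fix e e' assume "e \<in> cf_alphabet" "e' \<in> cf_alphabet" and eq: "digit_key e = digit_key e'"
  then obtain m n m' n' where e: "e = digit m n" "1 \<le> m" and e': "e' = digit m' n'" "1 \<le> m'"
    unfolding cf_alphabet_eq by auto
  have mm: "m = m'" "\<bar>n\<bar> = \<bar>n'\<bar>"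
    using digit_key_less[OF e(2) e'(2), of n n'] digit_key_less[OF e'(2) e(2), of n' n] eq
    unfolding e e' by linarith+
  then have "0 \<le> n \<longleftrightarrow> 0 \<le> n'" using eq by (auto simp: e e' digit_key_def Let_def split: if_splits)
  then show "e = e'" using mm by (auto simp: e e')
qed

section \<open>Explicit choices of dominating digits\<close>

lemma sum_squares_shift:
  fixes x y u v :: real
  shows "(x + u)\<^sup>2 + (y + v)\<^sup>2 = x\<^sup>2 + y\<^sup>2 + 2 * u * x + 2 * v * y + (u\<^sup>2 + v\<^sup>2)"
  by (simp add: power2_eq_square algebra_simps)

text \<open>The offsets lead to later digits near m + ki, and c gives the points of tangency. The
  quadratic inequality then fails only inside some disc, which must avoid the unit disc around (m+1,
  k). Digits near the origin need more offsets.\<close>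

lemma dominating_offsets_2:
  fixes m k :: int
  assumes "1 \<le> m" "0 \<le> k" "m + k \<ge> 2" "(m, k) \<noteq> (1, 1)"
  obtains O' :: "(int \<times> int) set" and c :: "int \<times> int \<Rightarrow> real" where "finite O'" "\<And>o'. o' \<in> O' \<Longrightarrow> 0 < c o'"
    "\<And>p q. (p, q) \<in> O' \<Longrightarrow> 0 \<le> p \<and> (m + k < m + p + \<bar>k + q\<bar> \<or> m + k = m + p + \<bar>k + q\<bar> \<and> 0 < p)"
    "\<And>x y. (x - (real_of_int m + 1))\<^sup>2 + (y - real_of_int k)\<^sup>2 \<le> 1 \<Longrightarrow>
      (\<Sum>(p, q)\<in>O'. 2 / c (p, q) ^ 3 * ((x + real_of_int p)\<^sup>2 + (y + real_of_int q)\<^sup>2)) \<le>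
      ((\<Sum>o'\<in>O'. 3 / (c o')\<^sup>2) - 1) * (x\<^sup>2 + y\<^sup>2)"
proof -
  have box: "real_of_int m \<le> x \<and> x \<le> m + 2 \<and> real_of_int k - 1 \<le> y \<and> y \<le> k + 1"
    if "(x - (real_of_int m + 1))\<^sup>2 + (y - real_of_int k)\<^sup>2 \<le> 1" for x y :: real
  proof -
    have "(x - (real_of_int m + 1))\<^sup>2 \<le> 1" "(y - real_of_int k)\<^sup>2 \<le> 1"
      using that zero_le_power2[of "x - (real_of_int m + 1)"] zero_le_power2[of "y - real_of_int k"] by linarith+
    then have "\<bar>x - (real_of_int m + 1)\<bar> \<le> 1" "\<bar>y - real_of_int k\<bar> \<le> 1"
      by (simp_all add: abs_square_le_1)
    then show ?thesis by (simp add: abs_le_iff)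
  qed
  consider "k = 0" "2 \<le> m" | "1 \<le> k" "3 \<le> m \<or> 3 \<le> k \<or> 2 \<le> m \<and> 2 \<le> k" | "m = 2" "k = 1" | "m = 1" "k = 2"
    using assms by force
  then show thesis
  proof cases
    case 1
    show thesis
    proof (rule that[of "{(0,1),(0,-1)}" "\<lambda>_. 3/2"])
      fix x y :: real assume xy: "(x - (real_of_int m + 1))\<^sup>2 + (y - real_of_int k)\<^sup>2 \<le> 1"
      define S where "S = x\<^sup>2 + y\<^sup>2"
      have "2\<^sup>2 \<le> x\<^sup>2" using box[OF xy] 1 by (intro power_mono) auto
      \<comment> \<open>More than enough: the claim amounts to 13 S \<ge> 32.\<close>
      then have "4 \<le> x\<^sup>2 + y\<^sup>2" by (simp add: add_increasing2)
      then show "(\<Sum>(p, q)\<in>{(0,1),(0,-1)}. 2 / (3/2) ^ 3 * ((x + real_of_int p)\<^sup>2 + (y + real_of_int q)\<^sup>2)) \<le>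
        ((\<Sum>o'\<in>{(0,1),(0,-1)::int\<times>int}. 3 / (3/2)\<^sup>2) - 1) * (x\<^sup>2 + y\<^sup>2)"
        unfolding sum_squares_shift S_def[symmetric] by (simp add: power_divide add_divide_distrib diff_divide_distrib)
    qed (use 1 in auto)
  next
    case 2
    show thesis
    proof (rule that[of "{(0,1),(1,0),(1,1),(1,-1)}" "\<lambda>_. 2"])
      fix x y :: real assume xy: "(x - (real_of_int m + 1))\<^sup>2 + (y - real_of_int k)\<^sup>2 \<le> 1"
      have "3 \<le> real_of_int m \<or> 3 \<le> real_of_int k \<or> 2 \<le> real_of_int m \<and> 2 \<le> real_of_int k"
        using 2(2) by simp
      then consider "3 \<le> x" | "2 \<le> y" | "2 \<le> x" "1 \<le> y"
        using box[OF xy] by linarith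
      \<comment> \<open>For these offsets the claim is S \<ge> 3/2 + 3/2 x + 1/2 y, that is, (x, y)
        is not inside this circle.\<close>
      then have far: "17/8 \<le> (x - 3/4)\<^sup>2 + (y - 1/4)\<^sup>2"
      proof cases
        case 1
        then have "(9/4)\<^sup>2 \<le> (x - 3/4)\<^sup>2" by (intro power_mono) auto
        moreover have "(9/4::real)\<^sup>2 = 81/16" by (simp add: power_divide)
        ultimately show ?thesis using zero_le_power2[of "y - 1/4"] by linarith
      next
        case 2
        then have "(7/4)\<^sup>2 \<le> (y - 1/4)\<^sup>2" by (intro power_mono) auto
        moreover have "(7/4::real)\<^sup>2 = 49/16" by (simp add: power_divide)
        ultimately show ?thesis using zero_le_power2[of "x - 3/4"] by linarith
      next
        case 3
        then have "(5/4)\<^sup>2 \<le> (x - 3/4)\<^sup>2" "(3/4)\<^sup>2 \<le> (y - 1/4)\<^sup>2" by (auto intro!: power_mono)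
        moreover have "(5/4::real)\<^sup>2 = 25/16" "(3/4::real)\<^sup>2 = 9/16" by (simp_all add: power_divide)
        ultimately show ?thesis by linarith
      qed
      define S where "S = x\<^sup>2 + y\<^sup>2"
      have "(x - 3/4)\<^sup>2 + (y - 1/4)\<^sup>2 = S - 3/2 * x - 1/2 * y + 5/8"
        by (simp add: S_def power2_eq_square algebra_simps)
      then have "3/2 + 3/2 * x + 1/2 * y \<le> S" using far by linarith
      then show "(\<Sum>(p, q)\<in>{(0,1),(1,0),(1,1),(1,-1)}. 2 / 2 ^ 3 * ((x + real_of_int p)\<^sup>2 + (y + real_of_int q)\<^sup>2)) \<le>
        ((\<Sum>o'\<in>{(0,1),(1,0),(1,1),(1,-1)::int\<times>int}. 3 / 2\<^sup>2) - 1) * (x\<^sup>2 + y\<^sup>2)"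
        unfolding sum_squares_shift S_def[symmetric] by (simp add: power_divide add_divide_distrib diff_divide_distrib)
    qed (use 2 in auto)
  next
    case 3
    show thesis
    proof (rule that[of "{(0,1),(1,0),(1,1),(1,-1),(1,-2)}" "\<lambda>_. 9/4"])
      fix x y :: real assume xy: "(x - (real_of_int m + 1))\<^sup>2 + (y - real_of_int k)\<^sup>2 \<le> 1"
      define S where "S = x\<^sup>2 + y\<^sup>2"
      \<comment> \<open>(21/10, 5/9) approximates the point of the unit disc nearest to the region
        of failure, where the claim is tightest; the square is combined with the inequality defining
        the unit disc.\<close>
      have "0 \<le> (x + - (21/10))\<^sup>2 + (y + - (5/9))\<^sup>2" by simp
      then have "0 \<le> x\<^sup>2 + y\<^sup>2 - 21/5 * x - 10/9 * y + (441/100 + 25/81)"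
        unfolding sum_squares_shift by (simp add: power2_eq_square[of "_ / _"])
      moreover have "x\<^sup>2 + y\<^sup>2 - 6 * x - 2 * y + 10 \<le> 1"
        using xy sum_squares_shift[of x "-3" y "-1"] unfolding 3 by simp
      ultimately show "(\<Sum>(p, q)\<in>{(0,1),(1,0),(1,1),(1,-1),(1,-2)}. 2 / (9/4) ^ 3 * ((x + real_of_int p)\<^sup>2 + (y + real_of_int q)\<^sup>2)) \<le>
        ((\<Sum>o'\<in>{(0,1),(1,0),(1,1),(1,-1),(1,-2)::int\<times>int}. 3 / (9/4)\<^sup>2) - 1) * (x\<^sup>2 + y\<^sup>2)"
        using box[OF xy] unfolding sum_squares_shift 3 S_def[symmetric] by (simp add: power_divide add_divide_distrib diff_divide_distrib)
    qed (use 3 in auto)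
  next
    case 4
    let ?c = "\<lambda>o'. if o' \<in> {(0,1),(1,0),(1,-1)} then 2 else 3 :: real"
    let ?O = "{(0,1),(1,0),(1,1),(1,-1),(2,-1),(0,2),(2,-2)} :: (int \<times> int) set"
    show thesis
    proof (rule that[of ?O ?c])
      fix x y :: real assume xy: "(x - (real_of_int m + 1))\<^sup>2 + (y - real_of_int k)\<^sup>2 \<le> 1"
      define S where "S = x\<^sup>2 + y\<^sup>2"
      \<comment> \<open>Again an approximation to the tightest point of the unit disc.\<close>
      have "0 \<le> (x + - (17/12))\<^sup>2 + (y + - (19/16))\<^sup>2" by simp
      then have "0 \<le> x\<^sup>2 + y\<^sup>2 - 17/6 * x - 19/8 * y + (289/144 + 361/256)"
        unfolding sum_squares_shift by (simp add: power2_eq_square[of "_ / _"])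
      moreover have "x\<^sup>2 + y\<^sup>2 - 4 * x - 4 * y + 8 \<le> 1"
        using xy sum_squares_shift[of x "-2" y "-2"] unfolding 4 by simp
      ultimately show "(\<Sum>(p, q)\<in>?O. 2 / ?c (p, q) ^ 3 * ((x + real_of_int p)\<^sup>2 + (y + real_of_int q)\<^sup>2)) \<le>
        ((\<Sum>o'\<in>?O. 3 / (?c o')\<^sup>2) - 1) * (x\<^sup>2 + y\<^sup>2)"
        using box[OF xy] unfolding sum_squares_shift 4 S_def[symmetric] by (simp add: power_divide add_divide_distrib diff_divide_distrib)
    qed (use 4 in auto)
  qed
qed

text \<open>The digit 1 + i at exponent 3/2. As in \<open>tangent_3_2\<close>, the points of
  tangency are the squares of the values of c.\<close>

lemma dominating_offsets_3_2:
  obtains O' :: "(int \<times> int) set" and c :: "int \<times> int \<Rightarrow> real" where "finite O'" "\<And>o'. o' \<in> O' \<Longrightarrow> 0 < c o'"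
    "\<And>p q. (p, q) \<in> O' \<Longrightarrow> 0 \<le> p \<and> (2 < 1 + p + \<bar>1 + q\<bar> \<or> 2 = 1 + p + \<bar>1 + q\<bar> \<and> 0 < p)"
    "\<And>x y. (x - 2)\<^sup>2 + (y - 1)\<^sup>2 \<le> 1 \<Longrightarrow>
      (\<Sum>(p, q)\<in>O'. 3 / 2 / c (p, q) ^ 5 * ((x + real_of_int p)\<^sup>2 + (y + real_of_int q)\<^sup>2)) \<le>
      ((\<Sum>o'\<in>O'. 5 / 2 / c o' ^ 3) - 1) * (x\<^sup>2 + y\<^sup>2)"
proof -
  let ?c = "\<lambda>o'. if o' = (0,1) then 3/2 else if o' \<in> {(2,0),(2,-1)} then 5/2 else 2 :: real"
  let ?O = "{(0,1),(1,0),(1,-1),(1,1),(1,-2),(0,2),(0,-3),(2,0),(2,-1)} :: (int \<times> int) set"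
  show thesis
  proof (rule that[of ?O ?c])
    fix x y :: real assume xy: "(x - 2)\<^sup>2 + (y - 1)\<^sup>2 \<le> 1"
    have "(x - 2)\<^sup>2 \<le> 1" "(y - 1)\<^sup>2 \<le> 1"
      using xy zero_le_power2[of "x - 2"] zero_le_power2[of "y - 1"] by linarith+
    then have "\<bar>x - 2\<bar> \<le> 1" "\<bar>y - 1\<bar> \<le> 1" by (simp_all add: abs_square_le_1)
    then have box: "1 \<le> x" "x \<le> 3" "0 \<le> y" "y \<le> 2" unfolding abs_le_iff by simp_all
    define S where "S = x\<^sup>2 + y\<^sup>2"
    have "0 \<le> (x + - (28/25))\<^sup>2 + (y + - (53/100))\<^sup>2" by simp
    then have "0 \<le> x\<^sup>2 + y\<^sup>2 - 56/25 * x - 53/50 * y + (784/625 + 2809/10000)"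
      unfolding sum_squares_shift by (simp add: power2_eq_square[of "_ / _"])
    moreover have "x\<^sup>2 + y\<^sup>2 - 4 * x - 2 * y + 5 \<le> 1"
      using xy sum_squares_shift[of x "-2" y "-1"] by simp
    \<comment> \<open>The claim multiplied by 16200000, the common denominator of its
      coefficients.\<close>
    ultimately have "8065656 * x + 1346086 * y + 22905113 \<le> 23105086 * S"
      using box unfolding S_def[symmetric] by linarith
    then show "(\<Sum>(p, q)\<in>?O. 3 / 2 / ?c (p, q) ^ 5 * ((x + real_of_int p)\<^sup>2 + (y + real_of_int q)\<^sup>2)) \<le>
      ((\<Sum>o'\<in>?O. 5 / 2 / ?c o' ^ 3) - 1) * (x\<^sup>2 + y\<^sup>2)"
      unfolding sum_squares_shift S_def[symmetric] by (simp add: power_divide add_divide_distrib diff_divide_distrib)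
  qed auto
qed

text \<open>Conjugation preserves the disc |\<zeta> - 1| \<le> 1 as well as m and m + |n|, so n can
  be replaced by k = |n|, with the offsets reflected by \<sigma>.\<close>

lemma dominating_tail:
  assumes e: "e \<in> cf_alphabet" "e \<noteq> 1" and T: "T = (if e \<in> {1 + \<i>, 1 - \<i>} then 3/2 else 2)"
  obtains D where "finite D" "D \<subseteq> cf_alphabet" "\<And>d. d \<in> D \<Longrightarrow> digit_key e < digit_key d"
    "\<And>t \<zeta>. 0 \<le> t \<Longrightarrow> t \<le> T \<Longrightarrow> \<zeta> \<in> cball 1 1 \<Longrightarrow>
      1 \<le> (\<Sum>d\<in>D. ((cmod (e + \<zeta>))\<^sup>2 / (cmod (d + \<zeta>))\<^sup>2) powr t)"
proof -
  note result = that
  obtain m n where mn: "e = digit m n" "1 \<le> m" using e(1) unfolding cf_alphabet_eq by auto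
  define \<sigma> :: int where "\<sigma> = (if 0 \<le> n then 1 else -1)"
  define k where "k = \<bar>n\<bar>"
  have \<sigma>: "\<sigma> = 1 \<or> \<sigma> = -1" and \<sigma>n: "\<sigma> * n = k" "n = \<sigma> * k" "0 \<le> k"
    by (auto simp: \<sigma>_def k_def)
  have \<sigma>k: "\<bar>n + \<sigma> * q\<bar> = \<bar>k + q\<bar>" for q using \<sigma> \<sigma>n by auto
  have "(m, k) \<noteq> (1, 0)" using e(2) mn \<sigma>n by (auto simp: digit_def)
  then have s2: "2 \<le> m + k" using mn(2) \<sigma>n(3) by auto
  have T_eq: "T = (if (m, k) = (1, 1) then 3/2 else 2)"
    unfolding T mn(1) k_def by (auto simp: digit_def complex_eq_iff)
  have finish: thesis
    if O': "finite O'" and off: "\<And>p q. (p, q) \<in> O' \<Longrightarrow> 0 \<le> p \<and>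
        (m + k < m + p + \<bar>k + q\<bar> \<or> m + k = m + p + \<bar>k + q\<bar> \<and> 0 < p)"
      and tangent: "\<And>o' b. o' \<in> O' \<Longrightarrow> 0 < b \<Longrightarrow> \<alpha> o' - \<beta> o' * b \<le> (1 / b) powr T"
      and quad: "\<And>x y :: real. (x - (real_of_int m + 1))\<^sup>2 + (y - real_of_int k)\<^sup>2 \<le> 1 \<Longrightarrow>
        (\<Sum>(p, q)\<in>O'. \<beta> (p, q) * ((x + real_of_int p)\<^sup>2 + (y + real_of_int q)\<^sup>2)) \<le>
        ((\<Sum>o'\<in>O'. \<alpha> o') - 1) * (x\<^sup>2 + y\<^sup>2)"
    for O' :: "(int \<times> int) set" and \<alpha> \<beta> :: "int \<times> int \<Rightarrow> real"
  proof -
    let ?D = "(\<lambda>(p, q). e + of_int p + of_int (\<sigma> * q) * \<i>) ` O'"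
    have D: "d \<in> cf_alphabet \<and> digit_key e < digit_key d" if d: "d \<in> ?D" for d
    proof -
      obtain p q where pq: "(p, q) \<in> O'" "d = e + of_int p + of_int (\<sigma> * q) * \<i>" using d by auto
      then have d_eq: "d = digit (m + p) (n + \<sigma> * q)" by (simp add: mn(1) digit_def algebra_simps)
      have "1 \<le> m + p" using off[OF pq(1)] mn(2) by simp
      moreover have "digit_key e < digit_key d"
        unfolding d_eq mn(1) using off[OF pq(1)] mn(2)
        by (intro digit_key_less) (simp_all only: \<sigma>k k_def[symmetric], auto)
      ultimately show ?thesis unfolding d_eq cf_alphabet_eq by auto
    qed
    show thesis
    proof (rule result[of ?D])
      fix t \<zeta> assume t: "0 \<le> t" "t \<le> T" and \<zeta>: "\<zeta> \<in> cball (1::complex) 1"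
      have "real_of_int \<sigma> * real_of_int n = real_of_int k" using \<sigma>n(1) by (metis of_int_mult)
      then have Re_Im: "Re e = real_of_int m" "real_of_int \<sigma> * Im e = real_of_int k" by (simp_all add: mn(1))
      show "1 \<le> (\<Sum>d\<in>?D. ((cmod (e + \<zeta>))\<^sup>2 / (cmod (d + \<zeta>))\<^sup>2) powr t)"
      proof (rule domination_of_offsets[OF _ \<sigma> t O' _ tangent _ \<zeta>])
        show "1 \<le> Re e" using mn by simp
        show "0 \<le> p" if "(p, q) \<in> O'" for p q using off[OF that] by simp
        show "(\<Sum>(p, q)\<in>O'. \<beta> (p, q) * ((x + real_of_int p)\<^sup>2 + (y + real_of_int q)\<^sup>2)) \<le>
            ((\<Sum>o'\<in>O'. \<alpha> o') - 1) * (x\<^sup>2 + y\<^sup>2)"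
          if "(x - (Re e + 1))\<^sup>2 + (y - real_of_int \<sigma> * Im e)\<^sup>2 \<le> 1" for x y :: real
          using that unfolding Re_Im by (rule quad)
      qed
    qed (use O' D in auto)
  qed
  show thesis
  proof (cases "(m, k) = (1, 1)")
    case True
    show thesis
    proof (rule dominating_offsets_3_2)
      fix O' :: "(int \<times> int) set" and c :: "int \<times> int \<Rightarrow> real"
      assume O': "finite O'" "\<And>o'. o' \<in> O' \<Longrightarrow> 0 < c o'"
      "\<And>p q. (p, q) \<in> O' \<Longrightarrow> 0 \<le> p \<and> (2 < 1 + p + \<bar>1 + q\<bar> \<or> 2 = 1 + p + \<bar>1 + q\<bar> \<and> 0 < p)"
      "\<And>x y. (x - 2)\<^sup>2 + (y - 1)\<^sup>2 \<le> 1 \<Longrightarrow>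
        (\<Sum>(p, q)\<in>O'. 3 / 2 / c (p, q) ^ 5 * ((x + real_of_int p)\<^sup>2 + (y + real_of_int q)\<^sup>2)) \<le>
        ((\<Sum>o'\<in>O'. 5 / 2 / c o' ^ 3) - 1) * (x\<^sup>2 + y\<^sup>2)"
      show thesis
      proof (rule finish[OF O'(1), of "\<lambda>o'. 5 / 2 / c o' ^ 3" "\<lambda>o'. 3 / 2 / c o' ^ 5"])
      show "5 / 2 / c o' ^ 3 - 3 / 2 / c o' ^ 5 * b \<le> (1 / b) powr T" if "o' \<in> O'" "0 < b" for o' b
        using tangent_3_2[OF that(2) O'(2)[OF that(1)]] True by (simp add: T_eq)
      qed (use O'(3,4) True in auto)
    qed
  next
    case False
    show thesis
    proof (rule dominating_offsets_2[OF mn(2) \<sigma>n(3) s2 False])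
      fix O' :: "(int \<times> int) set" and c :: "int \<times> int \<Rightarrow> real"
      assume O': "finite O'" "\<And>o'. o' \<in> O' \<Longrightarrow> 0 < c o'"
      "\<And>p q. (p, q) \<in> O' \<Longrightarrow> 0 \<le> p \<and> (m + k < m + p + \<bar>k + q\<bar> \<or> m + k = m + p + \<bar>k + q\<bar> \<and> 0 < p)"
      "\<And>x y. (x - (real_of_int m + 1))\<^sup>2 + (y - real_of_int k)\<^sup>2 \<le> 1 \<Longrightarrow>
        (\<Sum>(p, q)\<in>O'. 2 / c (p, q) ^ 3 * ((x + real_of_int p)\<^sup>2 + (y + real_of_int q)\<^sup>2)) \<le>
        ((\<Sum>o'\<in>O'. 3 / (c o')\<^sup>2) - 1) * (x\<^sup>2 + y\<^sup>2)"
      show thesis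
      proof (rule finish[OF O'(1), of "\<lambda>o'. 3 / (c o')\<^sup>2" "\<lambda>o'. 2 / c o' ^ 3"])
      show "3 / (c o')\<^sup>2 - 2 / c o' ^ 3 * b \<le> (1 / b) powr T" if "o' \<in> O'" "0 < b" for o' b
        using tangent_2[OF that(2) O'(2)[OF that(1)]] False unfolding T_eq by auto
      qed (use O'(3,4) in auto)
    qed
  qed
qed

subsection \<open>The exceptional digits \<open>1\<close> and \<open>1 \<plusminus> \<i>\<close>\<close>

text \<open>The test function is |1 + z|^(-2t). With b = 1 + z one has (d + z)(1 + 1/(d + z)) = b +
  d, so the hypothesis expresses its subinvariance.\<close>

lemma hausdorff_dim_J_le_of_weight:
  assumes F: "finite F" "F \<subseteq> cf_alphabet" and "0 < t"
    and le: "\<And>b. 1 \<le> Re b \<Longrightarrow> (cmod (b - 3/2))\<^sup>2 \<le> 1/4 \<Longrightarrow>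
      (\<Sum>d\<in>F. (1 / (cmod (b + d))\<^sup>2) powr t) \<le> (1 / (cmod b)\<^sup>2) powr t"
  shows "hausdorff_dim (J F) \<le> ennreal t"
proof (rule hausdorff_dim_J_le[OF F(2) \<open>0 < t\<close>])
  fix G n assume G: "finite G" "G \<subseteq> F"
  define f where "f z = (1 / (cmod (1 + z))\<^sup>2) powr t" for z
  define a :: real where "a = (1/4) powr t"
  have f_a: "a \<le> f z" and f_1: "f z \<le> 1" if z: "z \<in> cf_domain" for z
  proof -
    have c: "1 \<le> cmod (1 + z)" using cmod_digit_add_ge[of 1 z] z by simp
    have "cmod z \<le> 1" using cf_domain_dist[OF z zero_in_cf_domain] by simp
    then have "cmod (1 + z) \<le> 2" using norm_triangle_ineq[of 1 z] by simp
    then have "(cmod (1 + z))\<^sup>2 \<le> 2\<^sup>2" by (intro power_mono) auto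
    then have "1/4 \<le> 1 / (cmod (1 + z))\<^sup>2" using c by (intro frac_le) auto
    then show "a \<le> f z" unfolding a_def f_def using \<open>0 < t\<close> by (intro powr_mono2) auto
    have "1 / (cmod (1 + z))\<^sup>2 \<le> 1" using c by (simp add: divide_le_eq)
    then have "f z \<le> 1 powr t" unfolding f_def using \<open>0 < t\<close> by (intro powr_mono2) auto
    then show "f z \<le> 1" by simp
  qed
  have a: "0 < a" by (simp add: a_def)
  have "a * partition_sum G t n (1/2) \<le> f (1/2)"
  proof (rule partition_sum_le_of_subinvariant[OF G(1) _ a f_a _ half_in_cf_domain])
    show "G \<subseteq> cf_alphabet" using G F by auto
    fix z assume z: "z \<in> cf_domain"
    have weight: "wder [d] z powr t * f (cf_map d z) = (1 / (cmod ((1 + z) + d))\<^sup>2) powr t" if "d \<in> G" for d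
    proof -
      have d: "1 \<le> Re d" using that G F cf_alphabet_Re by auto
      have nz: "d + z \<noteq> 0" using cmod_digit_add_ge[OF d z] by auto
      have "wder [d] z powr t * f (cf_map d z) = (wder [d] z * (1 / (cmod (1 + cf_map d z))\<^sup>2)) powr t"
        unfolding f_def by (rule powr_mult[symmetric])
      also have "wder [d] z * (1 / (cmod (1 + cf_map d z))\<^sup>2) = 1 / (cmod ((d + z) * (1 + cf_map d z)))\<^sup>2"
        by (simp add: norm_mult power_mult_distrib)
      also have "(d + z) * (1 + cf_map d z) = (1 + z) + d" using nz by (simp add: cf_map_def field_simps)
      finally show ?thesis .
    qed
    have "(\<Sum>d\<in>G. wder [d] z powr t * f (cf_map d z)) = (\<Sum>d\<in>G. (1 / (cmod ((1 + z) + d))\<^sup>2) powr t)"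
      by (intro sum.cong refl weight)
    also have "\<dots> \<le> (\<Sum>d\<in>F. (1 / (cmod ((1 + z) + d))\<^sup>2) powr t)"
      using F G by (intro sum_mono2) auto
    also have "\<dots> \<le> f z"
      unfolding f_def
    proof (rule le)
      show "1 \<le> Re (1 + z)" using cf_domain_Re_nonneg[OF z] by simp
      have "cmod (1 + z - 3/2) \<le> 1/2"
        using z by (simp add: cf_domain_def dist_norm norm_minus_commute)
      then have "(cmod (1 + z - 3/2))\<^sup>2 \<le> (1/2)\<^sup>2" by (intro power_mono) auto
      then show "(cmod (1 + z - 3/2))\<^sup>2 \<le> 1/4" by (simp add: power2_eq_square)
    qed
    finally show "(\<Sum>d\<in>G. wder [d] z powr t * f (cf_map d z)) \<le> f z" .
  qed
  also have "f (1/2) \<le> 1" by (rule f_1[OF half_in_cf_domain])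
  finally show "partition_sum G t n (1/2) \<le> 1 / a" using a by (simp add: le_divide_eq mult.commute)
qed

lemma hausdorff_dim_J_1:
  assumes "0 < t"
  shows "hausdorff_dim (J {1}) \<le> ennreal t"
proof (rule hausdorff_dim_J_le_of_weight[OF _ _ assms])
  have "{1} = {digit 1 0}" by (simp add: digit_def)
  then show "{1} \<subseteq> cf_alphabet" unfolding cf_alphabet_eq by blast
  fix b :: complex assume b: "1 \<le> Re b"
  have "(cmod b)\<^sup>2 \<le> (cmod (b + 1))\<^sup>2" using b unfolding cmod_power2 by (simp add: power2_eq_square algebra_simps)
  moreover have "0 < (cmod b)\<^sup>2" using b by auto
  ultimately show "(\<Sum>d\<in>{1}. (1 / (cmod (b + d))\<^sup>2) powr t) \<le> (1 / (cmod b)\<^sup>2) powr t"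
    using assms by (auto intro!: powr_mono2 frac_le)
qed simp

text \<open>The weight criterion applies because |b + d|^2 \<ge> 9/4 |b|^2 for each of the three
  digits and 3 (4/9)^(3/2) = 8/9 < 1.\<close>

lemma hausdorff_dim_J_3: "hausdorff_dim (J {1, 1 + \<i>, 1 - \<i>}) \<le> ennreal (3/2)"
proof (rule hausdorff_dim_J_le_of_weight)
  have "{1, 1 + \<i>, 1 - \<i>} = {digit 1 0, digit 1 1, digit 1 (-1)}" by (simp add: digit_def)
  then show "{1, 1 + \<i>, 1 - \<i>} \<subseteq> cf_alphabet" unfolding cf_alphabet_eq by blast
  fix b :: complex assume b: "1 \<le> Re b" "(cmod (b - 3/2))\<^sup>2 \<le> 1/4"
  let ?x = "Re b" and ?y = "Im b"
  have disc: "?x\<^sup>2 + ?y\<^sup>2 \<le> 3 * ?x - 2"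
    using b(2) unfolding cmod_power2 by (simp add: power2_eq_square algebra_simps; linarith)
  have "(?x - 3/2)\<^sup>2 + ?y\<^sup>2 \<le> 1/4" using b(2) unfolding cmod_power2 by simp
  then have "(?x - 3/2)\<^sup>2 \<le> 1/4" "?y\<^sup>2 \<le> 1/4"
    using zero_le_power2[of "?x - 3/2"] zero_le_power2[of ?y] by linarith+
  moreover have "1/4 = (1/2::real)\<^sup>2" by (simp add: power_divide)
  ultimately have box: "\<bar>?x - 3/2\<bar> \<le> 1/2" "\<bar>?y\<bar> \<le> 1/2"
    by (simp_all only: power2_le_iff_abs_le)
  have x2: "?x \<le> 2" and y: "- 1 \<le> 2 * ?y" "2 * ?y \<le> 1" using box unfolding abs_le_iff by simp_all
  have pos: "0 < (cmod b)\<^sup>2" using b by auto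
  have each: "(1 / (cmod (b + d))\<^sup>2) powr (3/2) \<le> 8/27 * (1 / (cmod b)\<^sup>2) powr (3/2)"
    if "d \<in> {1, 1 + \<i>, 1 - \<i>}" for d
  proof -
    have "9/4 * (cmod b)\<^sup>2 \<le> (cmod (b + d))\<^sup>2"
    proof -
      \<comment> \<open>This is the case d = 1; for d = 1 \<plusminus> i the additional term 1
        \<plusminus> 2y is nonnegative.\<close>
      have "5 * ?x\<^sup>2 + 5 * ?y\<^sup>2 \<le> 4 + 8 * ?x" using disc x2 by linarith
      moreover have "(cmod (b + d))\<^sup>2 = ?x\<^sup>2 + ?y\<^sup>2 + 2 * Re d * ?x + 2 * Im d * ?y + ((Re d)\<^sup>2 + (Im d)\<^sup>2)"
        unfolding cmod_power2 plus_complex.sel by (rule sum_squares_shift)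
      ultimately show ?thesis using that y b(1) unfolding cmod_power2[of b] by auto
    qed
    then have "1 / (cmod (b + d))\<^sup>2 \<le> 1 / (9/4 * (cmod b)\<^sup>2)"
      using pos by (intro frac_le) auto
    then have "(1 / (cmod (b + d))\<^sup>2) powr (3/2) \<le> (4/9 * (1 / (cmod b)\<^sup>2)) powr (3/2)"
      by (intro powr_mono2) auto
    also have "\<dots> = (4/9) powr (3/2) * (1 / (cmod b)\<^sup>2) powr (3/2)" by (rule powr_mult)
    also have "(4/9::real) powr (3/2) = ((2/3) powr 2) powr (3/2)" by (simp add: power_divide)
    also have "\<dots> = (2/3) powr 3" by (simp only: powr_powr) simp
    also have "\<dots> = 8/27" by (simp add: power_divide)
    finally show ?thesis .
  qed
  have "(\<Sum>d\<in>{1, 1 + \<i>, 1 - \<i>}. (1 / (cmod (b + d))\<^sup>2) powr (3/2)) \<le>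
      real (card {1, 1 + \<i>, 1 - \<i>}) * (8/27 * (1 / (cmod b)\<^sup>2) powr (3/2))"
    by (rule sum_bounded_above) (rule each)
  also have "\<dots> \<le> 3 * (8/27 * (1 / (cmod b)\<^sup>2) powr (3/2))"
    by (intro mult_right_mono) (auto simp: card_insert_if)
  also have "\<dots> \<le> (1 / (cmod b)\<^sup>2) powr (3/2)" by simp
  finally show "(\<Sum>d\<in>{1, 1 + \<i>, 1 - \<i>}. (1 / (cmod (b + d))\<^sup>2) powr (3/2)) \<le> (1 / (cmod b)\<^sup>2) powr (3/2)" .
qed simp_all

subsection \<open>The greedy algorithm\<close>

text \<open>The order begins with 1, 1 - i, 1 + i: among the digits with m + |n| = 2, the digit 2
  comes last.\<close>

lemma digit_key_small:
  assumes "e \<in> cf_alphabet" "g \<in> cf_alphabet" "e \<in> {1, 1 + \<i>, 1 - \<i>}" "digit_key g < digit_key e"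
  shows "g \<in> {1, 1 + \<i>, 1 - \<i>} \<and> e \<noteq> 1"
proof -
  obtain m n where g: "g = digit m n" "1 \<le> m" using assms(2) unfolding cf_alphabet_eq by auto
  obtain k where e: "e = digit 1 k" "\<bar>k\<bar> \<le> 1"
  proof -
    have "e = digit 1 0 \<or> e = digit 1 1 \<or> e = digit 1 (-1)" using assms(3) by (auto simp: digit_def)
    then show thesis using that by fastforce
  qed
  have "\<not> (1 + \<bar>k\<bar> < m + \<bar>n\<bar> \<or> 1 + \<bar>k\<bar> = m + \<bar>n\<bar> \<and> 1 < m)"
  proof
    assume "1 + \<bar>k\<bar> < m + \<bar>n\<bar> \<or> 1 + \<bar>k\<bar> = m + \<bar>n\<bar> \<and> 1 < m"
    then have "digit_key e < digit_key g" unfolding g(1) e(1) by (rule digit_key_less[OF order_refl g(2)])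
    then show False using assms(4) by simp
  qed
  moreover have "k \<noteq> 0 \<or> n \<noteq> 0 \<or> m \<noteq> 1" using assms(4) g e by auto
  ultimately have "m = 1" "\<bar>n\<bar> \<le> 1" "k \<noteq> 0" using g(2) e(2) by linarith+
  moreover have "n = 0 \<or> n = 1 \<or> n = -1" using \<open>\<bar>n\<bar> \<le> 1\<close> by auto
  ultimately show ?thesis by (auto simp: g(1) e(1) digit_def complex_eq_iff)
qed

text \<open>Meant for the last rejected digit e, with G the digits accepted before it. If e = 1, or
  e = 1 \<plusminus> i and t \<ge> 3/2, the digits up to e form a system known to have dimension at
  most t; otherwise the exchange applies.\<close>

lemma hausdorff_dim_J_exchange_tail:
  assumes G: "G \<subseteq> cf_alphabet" "\<And>g. g \<in> G \<Longrightarrow> digit_key g < digit_key e" and e: "e \<in> cf_alphabet"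
    and F: "G \<subseteq> F" "F \<subseteq> cf_alphabet" "\<And>d. d \<in> cf_alphabet \<Longrightarrow> digit_key e < digit_key d \<Longrightarrow> d \<in> F"
    and dim: "hausdorff_dim (J F) < ennreal t" and t: "0 < t" "t \<le> 2"
  shows "hausdorff_dim (J (insert e G)) \<le> ennreal t"
proof -
  have finG: "finite G"
  proof (rule inj_on_finite)
    show "inj_on digit_key G" using inj_on_digit_key G(1) by (rule inj_on_subset)
    show "digit_key ` G \<subseteq> {..<digit_key e}" using G(2) by auto
  qed simp
  consider "e = 1" | "e \<in> {1 + \<i>, 1 - \<i>}" "3/2 \<le> t" | "e \<noteq> 1" "e \<in> {1 + \<i>, 1 - \<i>} \<longrightarrow> t \<le> 3/2"
    by fastforce
  then show ?thesis
  proof cases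
    case 1
    then have "G = {}" using digit_key_small[OF e] G by blast
    then show ?thesis using hausdorff_dim_J_1[OF t(1)] 1 by simp
  next
    case 2
    then have "insert e G \<subseteq> {1, 1 + \<i>, 1 - \<i>}" using digit_key_small[OF e] G by blast
    then have "hausdorff_dim (J (insert e G)) \<le> ennreal (3/2)"
      using hausdorff_dim_J_mono hausdorff_dim_J_3 order_trans by blast
    also have "\<dots> \<le> ennreal t" using 2 by (intro ennreal_leI)
    finally show ?thesis .
  next
    case 3
    obtain D where D: "finite D" "D \<subseteq> cf_alphabet" "\<And>d. d \<in> D \<Longrightarrow> digit_key e < digit_key d"
      "\<And>t \<zeta>. 0 \<le> t \<Longrightarrow> t \<le> (if e \<in> {1 + \<i>, 1 - \<i>} then 3/2 else 2) \<Longrightarrow> \<zeta> \<in> cball 1 1 \<Longrightarrow>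
        1 \<le> (\<Sum>d\<in>D. ((cmod (e + \<zeta>))\<^sup>2 / (cmod (d + \<zeta>))\<^sup>2) powr t)"
      using dominating_tail[OF e 3(1) refl] by metis
    show ?thesis
    proof (rule hausdorff_dim_J_exchange[OF finG G(1) D(1,2) _ e t(1)])
      show "G \<inter> D = {}" using G(2) D(3) by (metis disjoint_iff less_asym)
      show "1 \<le> (\<Sum>d\<in>D. ((cmod (e + \<zeta>))\<^sup>2 / (cmod (d + \<zeta>))\<^sup>2) powr t)" if "\<zeta> \<in> cball 1 1" for \<zeta>
        using D(4)[OF _ _ that] 3(2) t by auto
      have "G \<union> D \<subseteq> F" using F D by auto
      then show "hausdorff_dim (J (G \<union> D)) < ennreal t"
        using hausdorff_dim_J_mono dim le_less_trans by blast
    qed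
  qed
qed

lemma finite_cf_alphabet_bounded: "finite {e \<in> cf_alphabet. cmod e < R}"
proof (rule finite_subset)
  show "{e \<in> cf_alphabet. cmod e < R} \<subseteq> (\<lambda>(m, n). digit m n) ` ({-\<lceil>R\<rceil>..\<lceil>R\<rceil>} \<times> {-\<lceil>R\<rceil>..\<lceil>R\<rceil>})"
  proof
    fix e assume "e \<in> {e \<in> cf_alphabet. cmod e < R}"
    then obtain m n where e: "e = digit m n" "cmod e < R" unfolding cf_alphabet_eq by auto
    have "\<bar>real_of_int m\<bar> < R" "\<bar>real_of_int n\<bar> < R"
      using abs_Re_le_cmod[of e] abs_Im_le_cmod[of e] e by auto
    then have "\<bar>m\<bar> \<le> \<lceil>R\<rceil>" "\<bar>n\<bar> \<le> \<lceil>R\<rceil>" by linarith+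
    then show "e \<in> (\<lambda>(m, n). digit m n) ` ({-\<lceil>R\<rceil>..\<lceil>R\<rceil>} \<times> {-\<lceil>R\<rceil>..\<lceil>R\<rceil>})"
      using e by (auto intro!: image_eqI[of _ _ "(m, n)"])
  qed
qed auto

lemma exists_subsystem_of_dim:
  assumes t: "0 < t" "t \<le> 2" and dim: "ennreal t < hausdorff_dim (J cf_alphabet)"
  obtains F where "F \<subseteq> cf_alphabet" "hausdorff_dim (J F) = ennreal t"
proof -
  \<comment> \<open>\<open>G i\<close> is what has been accepted once all digits of key below i are
    examined; some keys belong to no digit.\<close>
  define G where "G = rec_nat {} (\<lambda>i H. H \<union> {e \<in> cf_alphabet. digit_key e = i \<and>
    hausdorff_dim (J (insert e H)) \<le> ennreal t})"
  have G_0: "G 0 = {}" and G_Suc: "G (Suc i) = G i \<union> {e \<in> cf_alphabet. digit_key e = i \<and>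
      hausdorff_dim (J (insert e (G i))) \<le> ennreal t}" for i
    by (simp_all add: G_def)
  define F where "F = (\<Union>i. G i)"
  have sub: "G i \<subseteq> cf_alphabet" for i
    by (induction i) (auto simp: G_0 G_Suc)
  have key: "digit_key g < i" if "g \<in> G i" for g i
    using that by (induction i) (auto simp: G_0 G_Suc less_Suc_eq)
  have G_mono: "G i \<subseteq> G j" if "i \<le> j" for i j
  proof (rule lift_Suc_mono_le[of G])
    show "G n \<subseteq> G (Suc n)" for n unfolding G_Suc by (rule Un_upper1)
  qed (rule that)
  have dim_G: "hausdorff_dim (J (G i)) \<le> ennreal t" for i
  proof (induction i)
    case 0
    show ?case by (simp add: G_0 J_empty hausdorff_dim_empty)
  next
    case (Suc i)
    show ?case
    proof (cases "G (Suc i) = G i")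
      case False
      then obtain e where e: "e \<in> cf_alphabet" "digit_key e = i" "hausdorff_dim (J (insert e (G i))) \<le> ennreal t"
        unfolding G_Suc by blast
      have "e' = e" if "e' \<in> cf_alphabet" "digit_key e' = i" for e'
        using that e by (intro inj_onD[OF inj_on_digit_key]) simp_all
      then have "G (Suc i) = insert e (G i)" using e unfolding G_Suc by blast
      then show ?thesis using e(3) by simp
    qed (use Suc in simp)
  qed
  have F: "F \<subseteq> cf_alphabet" using sub by (auto simp: F_def)
  have le: "hausdorff_dim (J F) \<le> ennreal t"
  proof (rule hausdorff_dim_J_le_of_finite[OF F t(1)])
    fix H assume H: "finite H" "H \<subseteq> F"
    then have "\<exists>i. H \<subseteq> G i"
    proof (induction H)
      case (insert h H)
      then obtain i j where "H \<subseteq> G i" "h \<in> G j" by (auto simp: F_def)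
      then have "insert h H \<subseteq> G (max i j)" using G_mono[of i "max i j"] G_mono[of j "max i j"] by auto
      then show ?case by blast
    qed simp
    then show "hausdorff_dim (J H) \<le> ennreal t"
      using dim_G hausdorff_dim_J_mono order_trans by blast
  qed
  have "\<not> hausdorff_dim (J F) < ennreal t"
  proof
    assume less: "hausdorff_dim (J F) < ennreal t"
    obtain R where R: "\<And>e. e \<in> cf_alphabet \<Longrightarrow> R \<le> cmod e \<Longrightarrow> hausdorff_dim (J (insert e F)) < ennreal t"
      using hausdorff_dim_J_insert_less[OF F less] by blast
    have rejected: "\<not> hausdorff_dim (J (insert e (G (digit_key e)))) \<le> ennreal t"
      if "e \<in> cf_alphabet - F" for e
    proof
      assume "hausdorff_dim (J (insert e (G (digit_key e)))) \<le> ennreal t"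
      then have "e \<in> G (Suc (digit_key e))" using that unfolding G_Suc by blast
      then show False using that unfolding F_def by blast
    qed
    \<comment> \<open>Adding a distant digit keeps the dimension below t even for all of F, so no
      such digit was rejected.\<close>
    have "cf_alphabet - F \<subseteq> {e \<in> cf_alphabet. cmod e < R}"
    proof
      fix e assume e: "e \<in> cf_alphabet - F"
      have "\<not> R \<le> cmod e"
      proof
        assume "R \<le> cmod e"
        have "insert e (G (digit_key e)) \<subseteq> insert e F" unfolding F_def by blast
        then have "hausdorff_dim (J (insert e (G (digit_key e)))) \<le> hausdorff_dim (J (insert e F))"
          by (rule hausdorff_dim_J_mono)
        also have "\<dots> < ennreal t" using e \<open>R \<le> cmod e\<close> by (intro R) simp_all
        finally show False using rejected[OF e] by simp
      qed
      then show "e \<in> {e \<in> cf_alphabet. cmod e < R}" using e by simp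
    qed
    then have fin: "finite (cf_alphabet - F)" using finite_cf_alphabet_bounded finite_subset by blast
    have "cf_alphabet - F \<noteq> {}"
    proof
      assume "cf_alphabet - F = {}"
      then have "F = cf_alphabet" using F by auto
      then show False using less dim by simp
    qed
    \<comment> \<open>The last rejected digit: all digits after it belong to F.\<close>
    then have "Max (digit_key ` (cf_alphabet - F)) \<in> digit_key ` (cf_alphabet - F)"
      using fin by (intro Max_in) auto
    then obtain e where e: "e \<in> cf_alphabet - F" "digit_key e = Max (digit_key ` (cf_alphabet - F))"
      by auto
    have last: "\<not> digit_key e < digit_key d" if "d \<in> cf_alphabet - F" for d
      unfolding e(2) not_less using fin that by (intro Max_ge) auto
    have "hausdorff_dim (J (insert e (G (digit_key e)))) \<le> ennreal t"
    proof (rule hausdorff_dim_J_exchange_tail[OF sub key _ _ F _ less t])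
      show "e \<in> cf_alphabet" using e by simp
      show "G (digit_key e) \<subseteq> F" by (auto simp: F_def)
      show "d \<in> F" if "d \<in> cf_alphabet" "digit_key e < digit_key d" for d
        using last[of d] that by blast
    qed
    then show False using rejected[OF e(1)] by simp
  qed
  then show ?thesis using that[OF F] le by simp
qed

theorem theorem1p4:
  shows "dimension_spectrum cf_map cf_domain cf_alphabet =
    {0..hausdorff_dim (limit_set cf_map cf_domain cf_alphabet)}"
proof
  show "dimension_spectrum cf_map cf_domain cf_alphabet \<subseteq> {0..hausdorff_dim (J cf_alphabet)}"
    by (auto simp: dimension_spectrum_def intro: hausdorff_dim_J_mono)
  show "{0..hausdorff_dim (J cf_alphabet)} \<subseteq> dimension_spectrum cf_map cf_domain cf_alphabet"
  proof
    fix s assume "s \<in> {0..hausdorff_dim (J cf_alphabet)}"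
    then consider "s = hausdorff_dim (J cf_alphabet)" | "s = 0" | "0 < s" "s < hausdorff_dim (J cf_alphabet)"
      by (auto simp: order_le_less)
    then show "s \<in> dimension_spectrum cf_map cf_domain cf_alphabet"
    proof cases
      case 1
      then show ?thesis by (auto simp: dimension_spectrum_def)
    next
      case 2
      then have "s = hausdorff_dim (J {})" by (simp add: J_empty hausdorff_dim_empty)
      then show ?thesis unfolding dimension_spectrum_def by blast
    next
      case 3
      have "s < ennreal 2" using 3(2) hausdorff_dim_J_le_2[OF order_refl] by (auto intro: less_le_trans)
      then obtain t where t: "s = ennreal t" "0 \<le> t" by (cases s) auto
      then have "0 < t" "t \<le> 2" using 3(1) \<open>s < ennreal 2\<close> by (auto simp: ennreal_less_iff)
      then obtain F where "F \<subseteq> cf_alphabet" "hausdorff_dim (J F) = s"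
        using exists_subsystem_of_dim[of t] 3(2) t by metis
      then show ?thesis unfolding dimension_spectrum_def by blast
    qed
  qed
qed

end
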